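(* Let $k\ge0$, let $T$ be a semi-classical arithmetic and let $X$ be a set of sentences of the language of $\mathsf{HA}$. Then $\mathsf{PA}+X$ is conservative over $T+X$ for all sentences in $\mathrm{E}_{k+1}$ if and only if $\mathsf{PA}+X$ is conservative over $T+X$ for all sentences in $\mathrm{E}\Sigma_{k+1}$.
   Context: $\mathsf{HA}$ is intuitionistic first-order arithmetic with function symbols for all primitive recursive functions and logical constants $\forall,\exists,\to,\land,\lor,\perp$; $\mathsf{PA}$ is $\mathsf{HA}$ plus excluded middle for all formulas. A semi-classical arithmetic is a theory $T$ in the language of $\mathsf{HA}$ with $\mathsf{HA}\subseteq T\subseteq\mathsf{PA}$; $T+X$ adds the sentences of $X$ as axioms. "$T'$ is conservative over $T$ for sentences in $\Gamma$" means every sentence of $\Gamma$ provable in $T'$ is provable in $T$. $\Sigma_0=\Pi_0$ = quantifier-free formulas; $\Sigma_{k+1}$ = formulas $\exists x_1\cdots\exists x_n\varphi$, $\varphi\in\Pi_k$; $\Pi_{k+1}$ = formulas $\forall x_1\cdots\forall x_n\varphi$, $\varphi\in\Sigma_k$. $\mathrm{E}\Pi_k$ is the smallest class containing $\Pi_k$ and closed under $\varphi,\psi\mapsto\varphi\lor\psi$ and $\varphi\mapsto\forall x\varphi$; $\mathrm{E}\Sigma_{k+1}$ is the class of formulas $\exists x_1\cdots\exists x_n\varphi$ with $\varphi\in\mathrm{E}\Pi_k$. Degree: an alternation path is a finite sequence of symbols $+,-$ in which they alternate; $i(s)$ is the first symbol of $s$ if nonempty and $\times$ if empty, $s^\perp$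 swaps $+$ and $-$, $l(s)$ is the length. $\mathrm{Alt}(\varphi)=\{\langle\rangle\}$ for quantifier-free $\varphi$; otherwise $\mathrm{Alt}(\varphi_1\land\varphi_2)=\mathrm{Alt}(\varphi_1\lor\varphi_2)=\mathrm{Alt}(\varphi_1)\cup\mathrm{Alt}(\varphi_2)$, $\mathrm{Alt}(\varphi_1\to\varphi_2)=\{s^\perp:s\in\mathrm{Alt}(\varphi_1)\}\cup\mathrm{Alt}(\varphi_2)$, $\mathrm{Alt}(\forall x\varphi_1)=\{s\in\mathrm{Alt}(\varphi_1):i(s)=-\}\cup\{-s:s\in\mathrm{Alt}(\varphi_1),i(s)\ne-\}$, $\mathrm{Alt}(\exists x\varphi_1)=\{s\in\mathrm{Alt}(\varphi_1):i(s)=+\}\cup\{+s:s\in\mathrm{Alt}(\varphi_1),i(s)\ne+\}$. $\deg(\varphi)=\max\{l(s):s\in\mathrm{Alt}(\varphi)\}$. $\mathrm{E}_{k+1}$ is the class of formulas $\varphi$ of degree exactly $k+1$ such that $i(s)=+$ for all $s\in\mathrm{Alt}(\varphi)$ with $l(s)=k+1$.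
   Formalization: For k=0, EΠ_0 is taken to be the quantifier-free formulas (not closed under ∀), so EΣ_1=Σ_1; with the literal closure the claim fails for T=HA, X=∅, by ∃x∀y(¬Prf_PA(y,⊥)∨Prf_PA(x,⊥)). For k≥1 the class is as defined. *)

theory Defs
  imports Main
begin

section \<open>The language of arithmetic\<close>

text \<open>
  One function symbol for every definition of a primitive recursive function. In \<open>Comp n f gs\<close> the
  arity \<open>n\<close> is recorded because \<open>gs\<close> may be empty. \<open>PRec f g\<close> recurses on its first argument.
\<close>

datatype sym =
    Zero
  | Succ
  | Proj nat nat
  | Comp nat sym "sym list"
  | PRec sym sym

primrec arity :: "sym \<Rightarrow> nat" where
  "arity Zero = 0"
| "arity Succ = 1"
| "arity (Proj n i) = n"
| "arity (Comp n f gs) = n"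
| "arity (PRec f g) = Suc (arity f)"

fun wf_sym :: "sym \<Rightarrow> bool" where
  "wf_sym Zero \<longleftrightarrow> True"
| "wf_sym Succ \<longleftrightarrow> True"
| "wf_sym (Proj n i) \<longleftrightarrow> i < n"
| "wf_sym (Comp n f gs) \<longleftrightarrow>
     wf_sym f \<and> arity f = length gs \<and> (\<forall>g\<in>set gs. wf_sym g \<and> arity g = n)"
| "wf_sym (PRec f g) \<longleftrightarrow> wf_sym f \<and> wf_sym g \<and> arity g = arity f + 2"

text \<open>Variables are de Bruijn indices, so formulas are taken up to renaming of bound variables.\<close>

datatype tm = Var nat | Fn sym "tm list"

datatype fm =
    Eq tm tm
  | Bot
  | And fm fm
  | Or fm fm
  | Imp fm fm
  | Forall fm
  | Exists fm

abbreviation Neg :: "fm \<Rightarrow> fm" where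
  "Neg \<phi> \<equiv> Imp \<phi> Bot"

fun wf_tm :: "tm \<Rightarrow> bool" where
  "wf_tm (Var n) \<longleftrightarrow> True"
| "wf_tm (Fn f ts) \<longleftrightarrow> wf_sym f \<and> length ts = arity f \<and> (\<forall>t\<in>set ts. wf_tm t)"

primrec wf_fm :: "fm \<Rightarrow> bool" where
  "wf_fm (Eq s t) \<longleftrightarrow> wf_tm s \<and> wf_tm t"
| "wf_fm Bot \<longleftrightarrow> True"
| "wf_fm (And \<phi> \<psi>) \<longleftrightarrow> wf_fm \<phi> \<and> wf_fm \<psi>"
| "wf_fm (Or \<phi> \<psi>) \<longleftrightarrow> wf_fm \<phi> \<and> wf_fm \<psi>"
| "wf_fm (Imp \<phi> \<psi>) \<longleftrightarrow> wf_fm \<phi> \<and> wf_fm \<psi>"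
| "wf_fm (Forall \<phi>) \<longleftrightarrow> wf_fm \<phi>"
| "wf_fm (Exists \<phi>) \<longleftrightarrow> wf_fm \<phi>"

fun fv_tm :: "tm \<Rightarrow> nat set" where
  "fv_tm (Var n) = {n}"
| "fv_tm (Fn f ts) = (\<Union>t\<in>set ts. fv_tm t)"

primrec fv :: "fm \<Rightarrow> nat set" where
  "fv (Eq s t) = fv_tm s \<union> fv_tm t"
| "fv Bot = {}"
| "fv (And \<phi> \<psi>) = fv \<phi> \<union> fv \<psi>"
| "fv (Or \<phi> \<psi>) = fv \<phi> \<union> fv \<psi>"
| "fv (Imp \<phi> \<psi>) = fv \<phi> \<union> fv \<psi>"
| "fv (Forall \<phi>) = {n. Suc n \<in> fv \<phi>}"
| "fv (Exists \<phi>) = {n. Suc n \<in> fv \<phi>}"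

definition sentence :: "fm \<Rightarrow> bool" where
  "sentence \<phi> \<longleftrightarrow> wf_fm \<phi> \<and> fv \<phi> = {}"

subsection \<open>Substitution\<close>

fun subst_tm :: "(nat \<Rightarrow> tm) \<Rightarrow> tm \<Rightarrow> tm" where
  "subst_tm \<sigma> (Var n) = \<sigma> n"
| "subst_tm \<sigma> (Fn f ts) = Fn f (map (subst_tm \<sigma>) ts)"

definition up :: "(nat \<Rightarrow> tm) \<Rightarrow> nat \<Rightarrow> tm" where
  "up \<sigma> = case_nat (Var 0) (\<lambda>n. subst_tm (Var \<circ> Suc) (\<sigma> n))"

primrec subst :: "(nat \<Rightarrow> tm) \<Rightarrow> fm \<Rightarrow> fm" where
  "subst \<sigma> (Eq s t) = Eq (subst_tm \<sigma> s) (subst_tm \<sigma> t)"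
| "subst \<sigma> Bot = Bot"
| "subst \<sigma> (And \<phi> \<psi>) = And (subst \<sigma> \<phi>) (subst \<sigma> \<psi>)"
| "subst \<sigma> (Or \<phi> \<psi>) = Or (subst \<sigma> \<phi>) (subst \<sigma> \<psi>)"
| "subst \<sigma> (Imp \<phi> \<psi>) = Imp (subst \<sigma> \<phi>) (subst \<sigma> \<psi>)"
| "subst \<sigma> (Forall \<phi>) = Forall (subst (up \<sigma>) \<phi>)"
| "subst \<sigma> (Exists \<phi>) = Exists (subst (up \<sigma>) \<phi>)"

definition lift :: "fm \<Rightarrow> fm" where
  "lift \<phi> = subst (Var \<circ> Suc) \<phi>"

text \<open>\<open>inst t \<phi>\<close> is the body \<open>\<phi>\<close> of a quantifier with the bound variable replaced by \<open>t\<close>.\<close>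

definition inst :: "tm \<Rightarrow> fm \<Rightarrow> fm" where
  "inst t \<phi> = subst (case_nat t Var) \<phi>"

section \<open>Intuitionistic logic with equality\<close>

text \<open>
  \<open>deriv A \<Gamma> \<phi>\<close>: natural deduction of \<open>\<phi>\<close> from the axioms \<open>A\<close> and the open assumptions \<open>\<Gamma>\<close>. The
  axioms are meant to be sentences, so they are not lifted in the quantifier rules.
\<close>

inductive deriv :: "fm set \<Rightarrow> fm list \<Rightarrow> fm \<Rightarrow> bool" for A :: "fm set" where
  Axm: "\<phi> \<in> A \<Longrightarrow> wf_fm \<phi> \<Longrightarrow> deriv A \<Gamma> \<phi>"
| Asm: "\<phi> \<in> set \<Gamma> \<Longrightarrow> wf_fm \<phi> \<Longrightarrow> deriv A \<Gamma> \<phi>"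
| BotE: "deriv A \<Gamma> Bot \<Longrightarrow> wf_fm \<phi> \<Longrightarrow> deriv A \<Gamma> \<phi>"
| AndI: "deriv A \<Gamma> \<phi> \<Longrightarrow> deriv A \<Gamma> \<psi> \<Longrightarrow> deriv A \<Gamma> (And \<phi> \<psi>)"
| AndE1: "deriv A \<Gamma> (And \<phi> \<psi>) \<Longrightarrow> deriv A \<Gamma> \<phi>"
| AndE2: "deriv A \<Gamma> (And \<phi> \<psi>) \<Longrightarrow> deriv A \<Gamma> \<psi>"
| OrI1: "deriv A \<Gamma> \<phi> \<Longrightarrow> wf_fm \<psi> \<Longrightarrow> deriv A \<Gamma> (Or \<phi> \<psi>)"
| OrI2: "deriv A \<Gamma> \<psi> \<Longrightarrow> wf_fm \<phi> \<Longrightarrow> deriv A \<Gamma> (Or \<phi> \<psi>)"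
| OrE: "deriv A \<Gamma> (Or \<phi> \<psi>) \<Longrightarrow> deriv A (\<phi> # \<Gamma>) \<chi> \<Longrightarrow> deriv A (\<psi> # \<Gamma>) \<chi> \<Longrightarrow> deriv A \<Gamma> \<chi>"
| ImpI: "deriv A (\<phi> # \<Gamma>) \<psi> \<Longrightarrow> wf_fm \<phi> \<Longrightarrow> deriv A \<Gamma> (Imp \<phi> \<psi>)"
| ImpE: "deriv A \<Gamma> (Imp \<phi> \<psi>) \<Longrightarrow> deriv A \<Gamma> \<phi> \<Longrightarrow> deriv A \<Gamma> \<psi>"
| ForallI: "deriv A (map lift \<Gamma>) \<phi> \<Longrightarrow> deriv A \<Gamma> (Forall \<phi>)"
| ForallE: "deriv A \<Gamma> (Forall \<phi>) \<Longrightarrow> wf_tm t \<Longrightarrow> deriv A \<Gamma> (inst t \<phi>)"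
| ExistsI: "deriv A \<Gamma> (inst t \<phi>) \<Longrightarrow> wf_tm t \<Longrightarrow> wf_fm \<phi> \<Longrightarrow> deriv A \<Gamma> (Exists \<phi>)"
| ExistsE: "deriv A \<Gamma> (Exists \<phi>) \<Longrightarrow> deriv A (\<phi> # map lift \<Gamma>) (lift \<chi>) \<Longrightarrow> wf_fm \<chi> \<Longrightarrow>
    deriv A \<Gamma> \<chi>"
| EqRefl: "wf_tm t \<Longrightarrow> deriv A \<Gamma> (Eq t t)"
| EqSubst: "deriv A \<Gamma> (Eq s t) \<Longrightarrow> deriv A \<Gamma> (inst s \<phi>) \<Longrightarrow> wf_tm s \<Longrightarrow> wf_tm t \<Longrightarrow> wf_fm \<phi> \<Longrightarrow>
    deriv A \<Gamma> (inst t \<phi>)"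

text \<open>Theories are given by sets of axioms; \<open>T + X\<close> is \<open>T \<union> X\<close>.\<close>

definition provable :: "fm set \<Rightarrow> fm \<Rightarrow> bool" (infix "\<turnstile>" 50) where
  "T \<turnstile> \<phi> \<longleftrightarrow> deriv T [] \<phi>"

definition theorems :: "fm set \<Rightarrow> fm set" where
  "theorems T = {\<phi>. sentence \<phi> \<and> T \<turnstile> \<phi>}"

section \<open>Heyting and Peano arithmetic\<close>

definition universal_closures :: "fm set \<Rightarrow> fm set" where
  "universal_closures S = {(Forall ^^ n) \<phi> | n \<phi>. \<phi> \<in> S \<and> fv \<phi> \<subseteq> {..<n}}"

abbreviation zero :: tm where "zero \<equiv> Fn Zero []"

abbreviation suc :: "tm \<Rightarrow> tm" where "suc t \<equiv> Fn Succ [t]"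

inductive_set successor_axioms :: "fm set" where
  suc_neq_zero: "Neg (Eq (suc (Var 0)) zero) \<in> successor_axioms"
| suc_inj: "Imp (Eq (suc (Var 0)) (suc (Var 1))) (Eq (Var 0) (Var 1)) \<in> successor_axioms"

inductive_set defining_equations :: "fm set" where
  proj: "wf_sym (Proj n i) \<Longrightarrow>
    Eq (Fn (Proj n i) (map Var [0..<n])) (Var i) \<in> defining_equations"
| comp: "wf_sym (Comp n f gs) \<Longrightarrow>
    Eq (Fn (Comp n f gs) (map Var [0..<n])) (Fn f (map (\<lambda>g. Fn g (map Var [0..<n])) gs))
      \<in> defining_equations"
| prec_zero: "wf_sym (PRec f g) \<Longrightarrow> xs = map Var [0..<arity f] \<Longrightarrow>
    Eq (Fn (PRec f g) (zero # xs)) (Fn f xs) \<in> defining_equations"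
| prec_suc: "wf_sym (PRec f g) \<Longrightarrow> y = Var 0 \<Longrightarrow> xs = map Var [1..<Suc (arity f)] \<Longrightarrow>
    Eq (Fn (PRec f g) (suc y # xs)) (Fn g (y # Fn (PRec f g) (y # xs) # xs)) \<in> defining_equations"

definition induction_axiom :: "fm \<Rightarrow> fm" where
  "induction_axiom \<phi> =
     Imp (And (inst zero \<phi>)
              (Forall (Imp \<phi> (subst (case_nat (suc (Var 0)) (Var \<circ> Suc)) \<phi>))))
         (Forall \<phi>)"

definition HA :: "fm set" where
  "HA = universal_closures
     (successor_axioms \<union> defining_equations \<union> {induction_axiom \<phi> | \<phi>. wf_fm \<phi>})"

definition PA :: "fm set" where
  "PA = HA \<union> universal_closures {Or \<phi> (Neg \<phi>) | \<phi>. wf_fm \<phi>}"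

definition semi_classical :: "fm set \<Rightarrow> bool" where
  "semi_classical T \<longleftrightarrow>
     (\<forall>\<phi>\<in>T. sentence \<phi>) \<and> theorems HA \<subseteq> theorems T \<and> theorems T \<subseteq> theorems PA"

definition conservative_over :: "fm set \<Rightarrow> fm set \<Rightarrow> fm set \<Rightarrow> bool" where
  "conservative_over T' T C \<longleftrightarrow> (\<forall>\<phi>\<in>C. sentence \<phi> \<longrightarrow> T' \<turnstile> \<phi> \<longrightarrow> T \<turnstile> \<phi>)"

section \<open>Classes of formulas\<close>

primrec quantifier_free :: "fm \<Rightarrow> bool" where
  "quantifier_free (Eq s t) \<longleftrightarrow> True"
| "quantifier_free Bot \<longleftrightarrow> True"
| "quantifier_free (And \<phi> \<psi>) \<longleftrightarrow> quantifier_free \<phi> \<and> quantifier_free \<psi>"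
| "quantifier_free (Or \<phi> \<psi>) \<longleftrightarrow> quantifier_free \<phi> \<and> quantifier_free \<psi>"
| "quantifier_free (Imp \<phi> \<psi>) \<longleftrightarrow> quantifier_free \<phi> \<and> quantifier_free \<psi>"
| "quantifier_free (Forall \<phi>) \<longleftrightarrow> False"
| "quantifier_free (Exists \<phi>) \<longleftrightarrow> False"

text \<open>Blocks of quantifiers may be empty, which makes the hierarchy cumulative.\<close>

fun Sigma_class :: "nat \<Rightarrow> fm set" and Pi_class :: "nat \<Rightarrow> fm set" where
  "Sigma_class 0 = {\<phi>. wf_fm \<phi> \<and> quantifier_free \<phi>}"
| "Sigma_class (Suc k) = {(Exists ^^ n) \<phi> | n \<phi>. \<phi> \<in> Pi_class k}"
| "Pi_class 0 = {\<phi>. wf_fm \<phi> \<and> quantifier_free \<phi>}"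
| "Pi_class (Suc k) = {(Forall ^^ n) \<phi> | n \<phi>. \<phi> \<in> Sigma_class k}"

text \<open>
  Closure under \<open>\<forall>\<close> is only imposed from level \<open>1\<close> on. At level \<open>0\<close> the class consists of the
  quantifier-free formulas, so that \<open>E\<Sigma>\<^sub>1 = \<Sigma>\<^sub>1\<close>. Closing level \<open>0\<close> under \<open>\<forall>\<close> would put the sentence
  \<open>\<exists>x. \<forall>y. \<not> P y \<or> P x\<close> of degree \<open>2\<close> into \<open>E\<Sigma>\<^sub>1\<close>. If \<open>P x\<close> says that \<open>x\<close> codes a proof of \<open>\<bottom>\<close> in
  Peano arithmetic, this sentence is provable in Peano but not in Heyting arithmetic, although the
  former is conservative over the latter for \<open>E\<^sub>1\<close>.
\<close>

inductive_set EPi_class :: "nat \<Rightarrow> fm set" for k :: nat where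
  base: "\<phi> \<in> Pi_class k \<Longrightarrow> \<phi> \<in> EPi_class k"
| disj: "\<phi> \<in> EPi_class k \<Longrightarrow> \<psi> \<in> EPi_class k \<Longrightarrow> Or \<phi> \<psi> \<in> EPi_class k"
| univ: "k \<ge> 1 \<Longrightarrow> \<phi> \<in> EPi_class k \<Longrightarrow> Forall \<phi> \<in> EPi_class k"

text \<open>\<open>ESigma_Suc k\<close> and \<open>E_Suc k\<close> are the classes \<open>E\<Sigma>\<close> and \<open>E\<close> with index \<open>k + 1\<close>.\<close>

definition ESigma_Suc :: "nat \<Rightarrow> fm set" where
  "ESigma_Suc k = {(Exists ^^ n) \<phi> | n \<phi>. \<phi> \<in> EPi_class k}"

subsection \<open>Alternation paths and degree\<close>

datatype sign = Plus | Minus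

primrec flip :: "sign \<Rightarrow> sign" where
  "flip Plus = Minus"
| "flip Minus = Plus"

text \<open>The first symbol of a path; \<open>None\<close> plays the role of the symbol \<open>\<times>\<close>.\<close>

definition initial :: "sign list \<Rightarrow> sign option" where
  "initial s = (case s of [] \<Rightarrow> None | c # _ \<Rightarrow> Some c)"

fun Alt :: "fm \<Rightarrow> sign list set" where
  "Alt (Eq s t) = {[]}"
| "Alt Bot = {[]}"
| "Alt (And \<phi> \<psi>) = (if quantifier_free (And \<phi> \<psi>) then {[]} else Alt \<phi> \<union> Alt \<psi>)"
| "Alt (Or \<phi> \<psi>) = (if quantifier_free (Or \<phi> \<psi>) then {[]} else Alt \<phi> \<union> Alt \<psi>)"
| "Alt (Imp \<phi> \<psi>) =
     (if quantifier_free (Imp \<phi> \<psi>) then {[]} else {map flip s | s. s \<in> Alt \<phi>} \<union> Alt \<psi>)"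
| "Alt (Forall \<phi>) =
     {s \<in> Alt \<phi>. initial s = Some Minus} \<union> {Minus # s | s. s \<in> Alt \<phi> \<and> initial s \<noteq> Some Minus}"
| "Alt (Exists \<phi>) =
     {s \<in> Alt \<phi>. initial s = Some Plus} \<union> {Plus # s | s. s \<in> Alt \<phi> \<and> initial s \<noteq> Some Plus}"

definition degree :: "fm \<Rightarrow> nat" where
  "degree \<phi> = Max (length ` Alt \<phi>)"

definition E_Suc :: "nat \<Rightarrow> fm set" where
  "E_Suc k = {\<phi>. wf_fm \<phi> \<and> degree \<phi> = k + 1 \<and>
     (\<forall>s\<in>Alt \<phi>. length s = k + 1 \<longrightarrow> initial s = Some Plus)}"

end

theory Submission
  imports Defs
begin

text \<open>
  The argument is purely logical. The negation normal form of \<open>\<phi>\<close> has the same alternation paths as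
  \<open>\<phi>\<close>, implies \<open>\<phi>\<close> intuitionistically, and is implied by \<open>\<phi>\<close> classically; so for conservativity only
  formulas in negation normal form matter. If \<open>P\<close> is prenex of level below \<open>k\<close>, the universal closure
  of the disjunction of \<open>P\<close> and its dual lies in \<open>E\<Pi>\<^sub>k\<close>, hence conservativity for \<open>E\<Sigma>\<^sub>k\<^sub>+\<^sub>1\<close> makes \<open>P\<close>
  decidable in \<open>T + X\<close>. Decidability justifies the shift from \<open>\<forall>x. A \<or> B\<close> to \<open>(\<forall>x. A) \<or> B\<close>, the
  only prenex step on negation normal forms that is not intuitionistic. At level \<open>k\<close>, where it is not
  available, \<open>E\<Pi>\<^sub>k\<close> is closed under disjunction anyway. So every negation normal form in \<open>E\<^sub>k\<^sub>+\<^sub>1\<close> is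
  equivalent in \<open>T + X\<close> to an \<open>E\<Sigma>\<^sub>k\<^sub>+\<^sub>1\<close> formula. Conversely, an \<open>E\<Sigma>\<^sub>k\<^sub>+\<^sub>1\<close> sentence becomes a member
  of \<open>E\<^sub>k\<^sub>+\<^sub>1\<close> after conjunction with a provable sentence of degree \<open>k + 1\<close>.
\<close>

section \<open>Substitution\<close>

lemma subst_tm_cong: "(\<And>n. n \<in> fv_tm t \<Longrightarrow> \<sigma> n = \<tau> n) \<Longrightarrow> subst_tm \<sigma> t = subst_tm \<tau> t"
  by (induction t) auto

lemma subst_cong: "(\<And>n. n \<in> fv \<phi> \<Longrightarrow> \<sigma> n = \<tau> n) \<Longrightarrow> subst \<sigma> \<phi> = subst \<tau> \<phi>"
proof (induction \<phi> arbitrary: \<sigma> \<tau>)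
  case (Eq s t)
  then show ?case by (auto intro!: subst_tm_cong)
next
  case (And \<phi> \<psi>)
  then show ?case by (metis UnCI fv.simps(3) subst.simps(3))
next
  case (Or \<phi> \<psi>)
  then show ?case by (metis UnCI fv.simps(4) subst.simps(4))
next
  case (Imp \<phi> \<psi>)
  then show ?case by (metis UnCI fv.simps(5) subst.simps(5))
next
  case (Forall \<phi>)
  have "subst (up \<sigma>) \<phi> = subst (up \<tau>) \<phi>"
    by (rule Forall.IH) (auto simp: up_def Forall.prems split: nat.split)
  then show ?case by simp
next
  case (Exists \<phi>)
  have "subst (up \<sigma>) \<phi> = subst (up \<tau>) \<phi>"
    by (rule Exists.IH) (auto simp: up_def Exists.prems split: nat.split)
  then show ?case by simp
qed auto

lemma subst_tm_Var [simp]: "subst_tm Var t = t"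
  by (induction t) (auto intro: map_idI)

lemma up_Var [simp]: "up Var = Var"
  by (auto simp: up_def fun_eq_iff split: nat.split)

lemma subst_Var [simp]: "subst Var \<phi> = \<phi>"
  by (induction \<phi>) auto

lemma subst_tm_comp: "subst_tm \<tau> (subst_tm \<sigma> t) = subst_tm (\<lambda>n. subst_tm \<tau> (\<sigma> n)) t"
  by (induction t) auto

lemma up_comp: "(\<lambda>n. subst_tm (up \<tau>) (up \<sigma> n)) = up (\<lambda>n. subst_tm \<tau> (\<sigma> n))"
  by (auto simp: up_def fun_eq_iff subst_tm_comp split: nat.split)

lemma subst_comp: "subst \<tau> (subst \<sigma> \<phi>) = subst (\<lambda>n. subst_tm \<tau> (\<sigma> n)) \<phi>"
  by (induction \<phi> arbitrary: \<sigma> \<tau>) (auto simp: subst_tm_comp up_comp)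

lemma wf_subst_tm: "wf_tm t \<Longrightarrow> (\<And>n. wf_tm (\<sigma> n)) \<Longrightarrow> wf_tm (subst_tm \<sigma> t)"
  by (induction t) auto

lemma wf_up: "(\<And>n. wf_tm (\<sigma> n)) \<Longrightarrow> wf_tm (up \<sigma> n)"
  by (auto simp: up_def wf_subst_tm split: nat.split)

lemma wf_subst: "wf_fm \<phi> \<Longrightarrow> (\<And>n. wf_tm (\<sigma> n)) \<Longrightarrow> wf_fm (subst \<sigma> \<phi>)"
  by (induction \<phi> arbitrary: \<sigma>) (auto simp: wf_subst_tm wf_up)

lemma wf_lift [simp]: "wf_fm \<phi> \<Longrightarrow> wf_fm (lift \<phi>)"
  by (simp add: lift_def wf_subst)

lemma wf_inst: "wf_fm \<phi> \<Longrightarrow> wf_tm t \<Longrightarrow> wf_fm (inst t \<phi>)"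
  by (auto simp: inst_def intro!: wf_subst split: nat.split)

section \<open>Free variables under renaming\<close>

lemma fv_tm_rename: "fv_tm (subst_tm (Var \<circ> f) t) = f ` fv_tm t"
  by (induction t) auto

lemma up_rename: "up (Var \<circ> f) = Var \<circ> case_nat 0 (Suc \<circ> f)"
  by (auto simp: up_def fun_eq_iff split: nat.split)

text \<open>The binder case of \<open>fv_rename\<close>: under a quantifier a renaming becomes
  \<open>case_nat 0 (Suc \<circ> f)\<close>, which fixes the bound index and, up to the shift, acts
  as \<open>f\<close> on the others.\<close>

lemma Suc_mem_rename: "Suc n \<in> case_nat 0 (Suc \<circ> f) ` A \<longleftrightarrow> n \<in> f ` {n. Suc n \<in> A}"
proof
  assume "Suc n \<in> case_nat 0 (Suc \<circ> f) ` A"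
  then obtain m where "m \<in> A" "Suc n = case_nat 0 (Suc \<circ> f) m" by blast
  then show "n \<in> f ` {n. Suc n \<in> A}" by (cases m) auto
next
  assume "n \<in> f ` {n. Suc n \<in> A}"
  then show "Suc n \<in> case_nat 0 (Suc \<circ> f) ` A" by force
qed

lemma fv_rename: "fv (subst (Var \<circ> f) \<phi>) = f ` fv \<phi>"
  by (induction \<phi> arbitrary: f)
    (simp_all add: fv_tm_rename up_rename Suc_mem_rename image_Un)

lemma fv_lift [simp]: "fv (lift \<phi>) = Suc ` fv \<phi>"
  by (simp add: lift_def fv_rename)

lemma lift_simps [simp]:
  "lift Bot = Bot"
  "lift (And \<phi> \<psi>) = And (lift \<phi>) (lift \<psi>)"
  "lift (Or \<phi> \<psi>) = Or (lift \<phi>) (lift \<psi>)"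
  "lift (Imp \<phi> \<psi>) = Imp (lift \<phi>) (lift \<psi>)"
  by (simp_all add: lift_def)

lemma inst_simps [simp]:
  "inst t (And \<phi> \<psi>) = And (inst t \<phi>) (inst t \<psi>)"
  "inst t (Or \<phi> \<psi>) = Or (inst t \<phi>) (inst t \<psi>)"
  by (simp_all add: inst_def)

lemma inst_lift [simp]: "inst t (lift \<phi>) = \<phi>"
  by (simp add: inst_def lift_def subst_comp)

text \<open>Behind the eigenvariable steps \<open>entails_lift_Forall\<close> and
  \<open>entails_lift_Exists\<close>: lifting a quantified formula leaves index 0 of its body alone,
  so putting the fresh \<open>Var 0\<close> there gives the body back.\<close>

lemma inst_Var_lifted_body: "inst (Var 0) (subst (up (Var \<circ> Suc)) \<phi>) = \<phi>"
proof -
  have "(\<lambda>n. subst_tm (case_nat (Var 0) Var) (up (Var \<circ> Suc) n)) = Var"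
    by (auto simp: up_def fun_eq_iff split: nat.split)
  then show ?thesis by (simp add: inst_def subst_comp)
qed

lemma inst_subst_up: "inst t (subst (up \<sigma>) \<phi>) = subst (case_nat t \<sigma>) \<phi>"
proof -
  have "(\<lambda>n. subst_tm (case_nat t Var) (up \<sigma> n)) = case_nat t \<sigma>"
    by (auto simp: up_def fun_eq_iff subst_tm_comp split: nat.split)
  then show ?thesis by (simp add: inst_def subst_comp)
qed

section \<open>Derivations\<close>

lemma deriv_wf: "deriv S \<Gamma> \<phi> \<Longrightarrow> wf_fm \<phi>"
  by (induction rule: deriv.induct) (auto simp: wf_inst)

lemma deriv_weaken: "deriv S \<Gamma> \<phi> \<Longrightarrow> set \<Gamma> \<subseteq> set \<Delta> \<Longrightarrow> deriv S \<Delta> \<phi>"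
proof (induction arbitrary: \<Delta> rule: deriv.induct)
  case (OrE \<Gamma> \<phi> \<psi> \<chi>)
  have "set (\<theta> # \<Gamma>) \<subseteq> set (\<theta> # \<Delta>)" for \<theta> using OrE.prems by auto
  then show ?case by (intro deriv.OrE[OF OrE.IH(1)[OF OrE.prems] OrE.IH(2) OrE.IH(3)])
next
  case (ImpE \<Gamma> \<phi> \<psi>)
  show ?case by (rule deriv.ImpE[OF ImpE.IH(1)[OF ImpE.prems] ImpE.IH(2)[OF ImpE.prems]])
next
  case (ForallI \<Gamma> \<phi>)
  show ?case by (rule deriv.ForallI, rule ForallI.IH) (use ForallI.prems in auto)
next
  case (ExistsE \<Gamma> \<phi> \<chi>)
  have "set (\<phi> # map lift \<Gamma>) \<subseteq> set (\<phi> # map lift \<Delta>)" using ExistsE.prems by auto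
  then show ?case
    by (rule deriv.ExistsE[OF ExistsE.IH(1)[OF ExistsE.prems] ExistsE.IH(2) ExistsE.hyps(3)])
next
  case (Axm \<phi> \<Gamma>)
  then show ?case by (simp add: deriv.Axm)
next
  case (Asm \<phi> \<Gamma>)
  then show ?case by (auto intro: deriv.Asm)
next
  case BotE
  show ?case by (rule deriv.BotE[OF BotE.IH[OF BotE.prems]]) (rule BotE.hyps)+
next
  case AndI
  show ?case by (rule deriv.AndI[OF AndI.IH(1)[OF AndI.prems] AndI.IH(2)[OF AndI.prems]])
next
  case AndE1
  show ?case by (rule deriv.AndE1[OF AndE1.IH[OF AndE1.prems]])
next
  case AndE2
  show ?case by (rule deriv.AndE2[OF AndE2.IH[OF AndE2.prems]])
next
  case OrI1
  show ?case by (rule deriv.OrI1[OF OrI1.IH[OF OrI1.prems]]) (rule OrI1.hyps)+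
next
  case OrI2
  show ?case by (rule deriv.OrI2[OF OrI2.IH[OF OrI2.prems]]) (rule OrI2.hyps)+
next
  case ForallE
  show ?case by (rule deriv.ForallE[OF ForallE.IH[OF ForallE.prems]]) (rule ForallE.hyps)+
next
  case ExistsI
  show ?case by (rule deriv.ExistsI[OF ExistsI.IH[OF ExistsI.prems]]) (rule ExistsI.hyps)+
next
  case EqSubst
  show ?case
    by (rule deriv.EqSubst[OF EqSubst.IH(1)[OF EqSubst.prems] EqSubst.IH(2)[OF EqSubst.prems]])
      (rule EqSubst.hyps)+
next
  case (ImpI \<phi> \<Gamma> \<psi>)
  show ?case by (rule deriv.ImpI, rule ImpI.IH) (use ImpI.prems ImpI.hyps in auto)
next
  case (EqRefl t \<Gamma>)
  then show ?case by (simp add: deriv.EqRefl)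
qed

lemma deriv_weaken_Nil: "deriv S [] \<phi> \<Longrightarrow> deriv S \<Gamma> \<phi>"
  by (erule deriv_weaken) simp

lemma deriv_hyp [simp]: "wf_fm \<phi> \<Longrightarrow> deriv S (\<phi> # \<Gamma>) \<phi>" "wf_fm \<phi> \<Longrightarrow> deriv S (\<psi> # \<phi> # \<Gamma>) \<phi>"
  by (auto intro: Asm)

lemma deriv_cut: "deriv S \<Gamma> \<phi> \<Longrightarrow> deriv S (\<phi> # \<Gamma>) \<psi> \<Longrightarrow> deriv S \<Gamma> \<psi>"
  by (rule ImpE[OF ImpI]) (auto dest: deriv_wf)

text \<open>The quantifier rules do not lift axioms, so a derivation of an axiom from no assumptions
  can be spliced in at any depth after weakening.\<close>

lemma deriv_axioms:
  assumes "deriv S \<Gamma> \<phi>" and "\<And>\<psi>. \<psi> \<in> S \<Longrightarrow> wf_fm \<psi> \<Longrightarrow> deriv S' [] \<psi>"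
  shows "deriv S' \<Gamma> \<phi>"
  using assms(1)
proof (induction rule: deriv.induct)
  case (Axm \<phi> \<Gamma>)
  then show ?case using assms(2) deriv_weaken_Nil by blast
qed (rule deriv.intros; assumption)+

section \<open>Universal closures\<close>

lemma deriv_Forall_funpow:
  assumes "deriv S \<Gamma> ((Forall ^^ n) \<phi>)" and "\<And>i. wf_tm (\<sigma> i)" and "\<And>i. \<sigma> (n + i) = Var i"
  shows "deriv S \<Gamma> (subst \<sigma> \<phi>)"
  using assms
proof (induction n arbitrary: \<phi> \<sigma>)
  case 0
  then have "\<sigma> = Var" by auto
  then show ?case using 0 by simp
next
  case (Suc n)
  \<comment> \<open>Index 0 belongs to the innermost quantifier. The outer \<open>n\<close> are
    removed first, with \<open>\<sigma> \<circ> Suc\<close>, and \<open>\<sigma> 0\<close> is kept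
    for the last one.\<close>
  have "deriv S \<Gamma> (subst (\<sigma> \<circ> Suc) (Forall \<phi>))"
    by (rule Suc.IH) (use Suc.prems in \<open>auto simp: funpow_swap1\<close>)
  then have "deriv S \<Gamma> (inst (\<sigma> 0) (subst (up (\<sigma> \<circ> Suc)) \<phi>))"
    using Suc.prems by (auto intro: ForallE)
  moreover have "case_nat (\<sigma> 0) (\<sigma> \<circ> Suc) = \<sigma>"
    by (auto simp: fun_eq_iff split: nat.split)
  ultimately show ?case by (simp add: inst_subst_up)
qed

lemma deriv_of_closure:
  assumes "deriv S \<Gamma> ((Forall ^^ n) \<phi>)" and "fv \<phi> \<subseteq> {..<n}"
  shows "deriv S \<Gamma> \<phi>"
proof -
  \<comment> \<open>The shift from \<open>n\<close> on is what \<open>deriv_Forall_funpow\<close>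
    requires. No free variable of \<open>\<phi>\<close> lies there, so on \<open>\<phi>\<close> the
    substitution is the identity.\<close>
  define \<sigma> where "\<sigma> i = (if i < n then Var i else Var (i - n))" for i
  have "deriv S \<Gamma> (subst \<sigma> \<phi>)"
    by (rule deriv_Forall_funpow[OF assms(1)]) (auto simp: \<sigma>_def)
  moreover have "subst \<sigma> \<phi> = subst Var \<phi>"
    by (rule subst_cong) (use assms(2) in \<open>auto simp: \<sigma>_def\<close>)
  ultimately show ?thesis by simp
qed

lemma deriv_closure: "deriv S [] \<phi> \<Longrightarrow> deriv S [] ((Forall ^^ n) \<phi>)"
  by (induction n) (auto intro: ForallI)

lemma fv_Forall_funpow: "fv ((Forall ^^ n) \<phi>) = {i. i + n \<in> fv \<phi>}"
  by (induction n) auto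

lemma wf_Forall_funpow [simp]: "wf_fm ((Forall ^^ n) \<phi>) = wf_fm \<phi>"
  by (induction n) auto

lemma finite_fv_tm: "finite (fv_tm t)"
  by (induction t) auto

lemma finite_fv: "finite (fv \<phi>)"
proof (induction \<phi>)
  case (Forall \<phi>)
  have "fv (Forall \<phi>) = Suc -` fv \<phi>" by auto
  then show ?case using Forall by (simp add: finite_vimageI)
next
  case (Exists \<phi>)
  have "fv (Exists \<phi>) = Suc -` fv \<phi>" by auto
  then show ?case using Exists by (simp add: finite_vimageI)
qed (auto simp: finite_fv_tm)

lemma obtain_closure:
  assumes "wf_fm \<phi>"
  obtains n where "fv \<phi> \<subseteq> {..<n}" and "sentence ((Forall ^^ n) \<phi>)"
proof -
  obtain n where n: "fv \<phi> \<subseteq> {..<n}"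
    using finite_nat_set_iff_bounded[of "fv \<phi>"] finite_fv[of \<phi>] by auto
  then have "sentence ((Forall ^^ n) \<phi>)"
    using assms by (auto simp: sentence_def fv_Forall_funpow)
  with n show ?thesis by (rule that)
qed

section \<open>Entailment\<close>

text \<open>Further hypotheses are packed into a conjunction. The well-formedness of
  \<open>\<phi>\<close> is stated because \<open>deriv\<close> does not force it on its
  assumptions.\<close>

definition entails :: "fm set \<Rightarrow> fm \<Rightarrow> fm \<Rightarrow> bool" where
  "entails S \<phi> \<psi> \<longleftrightarrow> wf_fm \<phi> \<and> deriv S [\<phi>] \<psi>"

lemma entails_wf: "entails S \<phi> \<psi> \<Longrightarrow> wf_fm \<phi> \<and> wf_fm \<psi>"
  by (auto simp: entails_def dest: deriv_wf)

lemma entails_refl: "wf_fm \<phi> \<Longrightarrow> entails S \<phi> \<phi>"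
  by (auto simp: entails_def intro: Asm)

lemma entails_deriv: "entails S \<phi> \<psi> \<Longrightarrow> deriv S \<Gamma> \<phi> \<Longrightarrow> deriv S \<Gamma> \<psi>"
  unfolding entails_def
  by (metis deriv_cut deriv_weaken empty_set empty_subsetI insert_mono list.simps(15))

lemma entails_trans: "entails S \<phi> \<psi> \<Longrightarrow> entails S \<psi> \<chi> \<Longrightarrow> entails S \<phi> \<chi>"
  using entails_deriv entails_def by blast

lemma entails_theorem: "S \<turnstile> \<psi> \<Longrightarrow> wf_fm \<phi> \<Longrightarrow> entails S \<phi> \<psi>"
  by (auto simp: entails_def provable_def intro: deriv_weaken_Nil)

lemma entails_BotI: "wf_fm \<phi> \<Longrightarrow> entails S Bot \<phi>"
  by (simp add: entails_def BotE)

lemma entails_AndI: "entails S \<phi> \<psi> \<Longrightarrow> entails S \<phi> \<chi> \<Longrightarrow> entails S \<phi> (And \<psi> \<chi>)"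
  by (auto simp: entails_def intro: AndI)

lemma entails_And1: "entails S \<phi> \<chi> \<Longrightarrow> wf_fm \<psi> \<Longrightarrow> entails S (And \<phi> \<psi>) \<chi>"
  by (rule entails_trans[of S _ \<phi>]) (auto simp: entails_def intro!: AndE1[of S _ \<phi> \<psi>])

lemma entails_And2: "entails S \<psi> \<chi> \<Longrightarrow> wf_fm \<phi> \<Longrightarrow> entails S (And \<phi> \<psi>) \<chi>"
  by (rule entails_trans[of S _ \<psi>]) (auto simp: entails_def intro!: AndE2[of S _ \<phi> \<psi>])

lemma entails_Or1: "entails S \<chi> \<phi> \<Longrightarrow> wf_fm \<psi> \<Longrightarrow> entails S \<chi> (Or \<phi> \<psi>)"
  by (auto simp: entails_def intro: OrI1)

lemma entails_Or2: "entails S \<chi> \<psi> \<Longrightarrow> wf_fm \<phi> \<Longrightarrow> entails S \<chi> (Or \<phi> \<psi>)"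
  by (auto simp: entails_def intro: OrI2)

lemma entails_OrE: "entails S \<phi> \<chi> \<Longrightarrow> entails S \<psi> \<chi> \<Longrightarrow> entails S (Or \<phi> \<psi>) \<chi>"
  using OrE[of S "[Or \<phi> \<psi>]" \<phi> \<psi> \<chi>] deriv_weaken[of S "[\<phi>]" \<chi> "[\<phi>, Or \<phi> \<psi>]"]
    deriv_weaken[of S "[\<psi>]" \<chi> "[\<psi>, Or \<phi> \<psi>]"]
  by (simp add: entails_def)

lemma entails_ImpI: "entails S (And \<phi> \<psi>) \<chi> \<Longrightarrow> entails S \<phi> (Imp \<psi> \<chi>)"
  using entails_deriv[of S "And \<phi> \<psi>" \<chi> "[\<psi>, \<phi>]"]
  by (simp add: entails_def ImpI AndI)

lemma entails_ImpE: "entails S \<phi> (Imp \<psi> \<chi>) \<Longrightarrow> entails S \<phi> \<psi> \<Longrightarrow> entails S \<phi> \<chi>"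
  using ImpE[of S "[\<phi>]" \<psi> \<chi>] by (simp add: entails_def)

lemma entails_cases:
  assumes "entails S \<phi> (Or \<psi> \<chi>)" "entails S (And \<phi> \<psi>) \<theta>" "entails S (And \<phi> \<chi>) \<theta>"
  shows "entails S \<phi> \<theta>"
proof -
  have wf: "wf_fm \<phi>" "wf_fm \<psi>" "wf_fm \<chi>" using assms by (auto dest!: entails_wf)
  have "deriv S [\<psi>, \<phi>] \<theta>" "deriv S [\<chi>, \<phi>] \<theta>"
    using wf by (simp_all add: entails_deriv[OF assms(2)] entails_deriv[OF assms(3)] AndI)
  then show ?thesis using assms(1) OrE[of S "[\<phi>]" \<psi> \<chi> \<theta>] by (simp add: entails_def)
qed

lemmas entails_prop = entails_AndI entails_And1 entails_And2 entails_refl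

section \<open>Quantifier rules for entailment\<close>

lemma entails_ForallI: "entails S (lift \<phi>) \<psi> \<Longrightarrow> wf_fm \<phi> \<Longrightarrow> entails S \<phi> (Forall \<psi>)"
  by (auto simp: entails_def intro: ForallI)

lemma entails_lift_Forall: "wf_fm \<phi> \<Longrightarrow> entails S (lift (Forall \<phi>)) \<phi>"
  using ForallE[of S "[lift (Forall \<phi>)]" "subst (up (Var \<circ> Suc)) \<phi>" "Var 0"]
    wf_lift[of "Forall \<phi>"]
  by (simp add: entails_def inst_Var_lifted_body lift_def)

lemma entails_Forall_inst: "wf_fm \<phi> \<Longrightarrow> wf_tm t \<Longrightarrow> entails S (Forall \<phi>) (inst t \<phi>)"
  by (auto simp: entails_def intro: ForallE)

lemma entails_Exists_inst: "wf_fm \<phi> \<Longrightarrow> wf_tm t \<Longrightarrow> entails S (inst t \<phi>) (Exists \<phi>)"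
  by (simp add: entails_def wf_inst ExistsI[of _ _ t])

lemma entails_lift_Exists: "wf_fm \<phi> \<Longrightarrow> entails S \<phi> (lift (Exists \<phi>))"
  using ExistsI[of S "[\<phi>]" "Var 0" "subst (up (Var \<circ> Suc)) \<phi>"] wf_lift[of "Exists \<phi>"]
  by (simp add: entails_def inst_Var_lifted_body lift_def)

lemma entails_ExistsE: "entails S \<phi> (lift \<psi>) \<Longrightarrow> wf_fm \<psi> \<Longrightarrow> entails S (Exists \<phi>) \<psi>"
  using ExistsE[of S "[Exists \<phi>]" \<phi> \<psi>]
    deriv_weaken[of S "[\<phi>]" "lift \<psi>" "[\<phi>, lift (Exists \<phi>)]"]
  by (simp add: entails_def)

lemma entails_And_mono: "entails S \<phi> \<phi>' \<Longrightarrow> entails S \<psi> \<psi>' \<Longrightarrow> entails S (And \<phi> \<psi>) (And \<phi>' \<psi>')"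
  by (simp add: entails_AndI entails_And1 entails_And2 entails_wf)

lemma entails_Or_mono: "entails S \<phi> \<phi>' \<Longrightarrow> entails S \<psi> \<psi>' \<Longrightarrow> entails S (Or \<phi> \<psi>) (Or \<phi>' \<psi>')"
  by (simp add: entails_OrE entails_Or1 entails_Or2 entails_wf)

lemma entails_Forall_mono: "entails S \<phi> \<psi> \<Longrightarrow> entails S (Forall \<phi>) (Forall \<psi>)"
  by (meson entails_ForallI entails_lift_Forall entails_trans entails_wf wf_fm.simps(6))

lemma entails_Exists_mono: "entails S \<phi> \<psi> \<Longrightarrow> entails S (Exists \<phi>) (Exists \<psi>)"
  by (meson entails_ExistsE entails_lift_Exists entails_trans entails_wf wf_fm.simps(7))

lemma entails_contra: "entails S \<phi> \<psi> \<Longrightarrow> entails S \<phi> (Neg \<psi>) \<Longrightarrow> wf_fm \<chi> \<Longrightarrow> entails S \<phi> \<chi>"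
  using entails_BotI entails_ImpE entails_trans by blast

lemma entails_hyp1: "wf_fm \<phi> \<Longrightarrow> wf_fm \<psi> \<Longrightarrow> entails S (And \<phi> \<psi>) \<phi>"
  by (simp add: entails_And1 entails_refl)

lemma entails_hyp2: "wf_fm \<phi> \<Longrightarrow> wf_fm \<psi> \<Longrightarrow> entails S (And \<phi> \<psi>) \<psi>"
  by (simp add: entails_And2 entails_refl)

lemma entails_Neg_swap:
  assumes "entails S \<phi> (Neg \<psi>)"
  shows "entails S \<psi> (Neg \<phi>)"
proof (rule entails_ImpI)
  have wf: "wf_fm \<phi>" "wf_fm \<psi>" using entails_wf[OF assms] by auto
  show "entails S (And \<psi> \<phi>) Bot"
    by (rule entails_ImpE[OF entails_And2[OF assms] entails_hyp1]) (use wf in auto)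
qed

lemma entails_Neg_mono:
  assumes "entails S \<phi> \<psi>"
  shows "entails S (Neg \<psi>) (Neg \<phi>)"
proof -
  have "entails S \<psi> (Neg (Neg \<psi>))"
    by (rule entails_Neg_swap, rule entails_refl) (use entails_wf[OF assms] in simp)
  then show ?thesis by (rule entails_Neg_swap[OF entails_trans[OF assms]])
qed

lemma entails_Imp_weaken: "entails S \<phi> \<chi> \<Longrightarrow> wf_fm \<psi> \<Longrightarrow> entails S \<phi> (Imp \<psi> \<chi>)"
  by (simp add: entails_ImpI entails_And1)

lemma entails_Neg_Imp: "wf_fm \<phi> \<Longrightarrow> wf_fm \<psi> \<Longrightarrow> entails S (Neg \<phi>) (Imp \<phi> \<psi>)"
  by (rule entails_ImpI, rule entails_contra[of S _ \<phi>]) (simp_all add: entails_hyp1 entails_hyp2)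

lemma entails_Neg_Or:
  assumes "entails S \<chi> (Neg \<phi>)" "entails S \<chi> (Neg \<psi>)"
  shows "entails S \<chi> (Neg (Or \<phi> \<psi>))"
  by (rule entails_Neg_swap, rule entails_OrE; rule entails_Neg_swap, rule assms)

section \<open>Equivalence and quantifier shifts\<close>

text \<open>Equal free variables are demanded so that an equivalent of a sentence is again a
  sentence, to which conservativity can be applied.\<close>

definition equivalent :: "fm set \<Rightarrow> fm \<Rightarrow> fm \<Rightarrow> bool" where
  "equivalent S \<phi> \<psi> \<longleftrightarrow> entails S \<phi> \<psi> \<and> entails S \<psi> \<phi> \<and> fv \<phi> = fv \<psi>"

lemma equivalent_wf: "equivalent S \<phi> \<psi> \<Longrightarrow> wf_fm \<phi> \<and> wf_fm \<psi>"
  by (auto simp: equivalent_def dest: entails_wf)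

lemma equivalent_refl: "wf_fm \<phi> \<Longrightarrow> equivalent S \<phi> \<phi>"
  by (simp add: equivalent_def entails_refl)

lemma equivalent_trans: "equivalent S \<phi> \<psi> \<Longrightarrow> equivalent S \<psi> \<chi> \<Longrightarrow> equivalent S \<phi> \<chi>"
  by (auto simp: equivalent_def intro: entails_trans)

lemma equivalent_And_cong:
  "equivalent S \<phi> \<phi>' \<Longrightarrow> equivalent S \<psi> \<psi>' \<Longrightarrow> equivalent S (And \<phi> \<psi>) (And \<phi>' \<psi>')"
  by (simp add: equivalent_def entails_And_mono)

lemma equivalent_Or_cong:
  "equivalent S \<phi> \<phi>' \<Longrightarrow> equivalent S \<psi> \<psi>' \<Longrightarrow> equivalent S (Or \<phi> \<psi>) (Or \<phi>' \<psi>')"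
  by (simp add: equivalent_def entails_Or_mono)

lemma equivalent_And_comm: "wf_fm \<phi> \<Longrightarrow> wf_fm \<psi> \<Longrightarrow> equivalent S (And \<phi> \<psi>) (And \<psi> \<phi>)"
  by (auto simp: equivalent_def entails_AndI entails_hyp1 entails_hyp2)

lemma equivalent_Or_comm: "wf_fm \<phi> \<Longrightarrow> wf_fm \<psi> \<Longrightarrow> equivalent S (Or \<phi> \<psi>) (Or \<psi> \<phi>)"
  by (auto simp: equivalent_def entails_OrE entails_Or1 entails_Or2 entails_refl)

lemma And_Or_distrib:
  assumes wf: "wf_fm \<phi>" "wf_fm \<psi>" "wf_fm \<chi>"
  shows "equivalent S (And \<phi> (Or \<psi> \<chi>)) (Or (And \<phi> \<psi>) (And \<phi> \<chi>))"
proof -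
  let ?L = "And \<phi> (Or \<psi> \<chi>)" and ?R = "Or (And \<phi> \<psi>) (And \<phi> \<chi>)"
  have "entails S ?L ?R"
  proof (rule entails_cases[of S _ \<psi> \<chi>])
    show "entails S ?L (Or \<psi> \<chi>)" using wf by (simp add: entails_hyp2)
    show "entails S (And ?L \<psi>) ?R"
      using wf by (intro entails_Or1) (simp_all add: entails_prop)
    show "entails S (And ?L \<chi>) ?R"
      using wf by (intro entails_Or2) (simp_all add: entails_prop)
  qed
  moreover have "entails S ?R ?L"
    using wf by (intro entails_OrE entails_And_mono entails_Or1 entails_Or2 entails_refl) auto
  ultimately show ?thesis by (auto simp: equivalent_def)
qed

text \<open>Quantifiers are named by the symbol they contribute to alternation paths, so that dual
  cases are treated by one proof.\<close>

primrec quant :: "sign \<Rightarrow> fm \<Rightarrow> fm" where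
  "quant Plus = Exists"
| "quant Minus = Forall"

lemma flip_flip [simp]: "flip (flip c) = c"
  by (cases c) auto

lemma flip_neq [simp]: "flip c \<noteq> c" "c \<noteq> flip c"
  by (cases c; simp)+

lemma sign_neq_iff: "c \<noteq> d \<longleftrightarrow> c = flip d"
  by (cases c; cases d) auto

lemma wf_quant [simp]: "wf_fm (quant c \<phi>) = wf_fm \<phi>"
  by (cases c) auto

lemma subst_quant [simp]: "subst \<sigma> (quant c \<phi>) = quant c (subst (up \<sigma>) \<phi>)"
  by (cases c) auto

lemma equivalent_quant_cong: "equivalent S \<phi> \<psi> \<Longrightarrow> equivalent S (quant c \<phi>) (quant c \<psi>)"
  by (cases c) (auto simp: equivalent_def entails_Forall_mono entails_Exists_mono)

lemma Suc_in_fv_lift [simp]: "Suc n \<in> fv (lift \<phi>) \<longleftrightarrow> n \<in> fv \<phi>"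
  by auto

lemma Exists_And:
  assumes wf: "wf_fm \<phi>" "wf_fm \<psi>"
  shows "equivalent S (And (Exists \<phi>) \<psi>) (Exists (And \<phi> (lift \<psi>)))"
proof -
  let ?R = "Exists (And \<phi> (lift \<psi>))"
  \<comment> \<open>Existential elimination acts on a single hypothesis, so \<open>\<psi>\<close>
    waits on the right as the premise of an implication.\<close>
  have "entails S (Exists \<phi>) (Imp \<psi> ?R)"
    using wf by (intro entails_ExistsE) (auto intro!: entails_ImpI entails_lift_Exists)
  then have "entails S (And (Exists \<phi>) \<psi>) ?R"
    using wf by (intro entails_ImpE[OF entails_And1 entails_hyp2]) auto
  moreover have "entails S ?R (And (Exists \<phi>) \<psi>)"
    using wf by (intro entails_ExistsE)
      (simp_all add: entails_AndI entails_And1 entails_lift_Exists entails_hyp2)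
  ultimately show ?thesis by (auto simp: equivalent_def)
qed

lemma Exists_Or:
  assumes wf: "wf_fm \<phi>" "wf_fm \<psi>"
  shows "equivalent S (Or (Exists \<phi>) \<psi>) (Exists (Or \<phi> (lift \<psi>)))"
proof -
  let ?R = "Exists (Or \<phi> (lift \<psi>))"
  have "entails S (Exists \<phi>) ?R"
    using wf by (intro entails_Exists_mono entails_Or1 entails_refl) auto
  \<comment> \<open>The bound variable does not occur in \<open>lift \<psi>\<close>, so any term is
    a witness.\<close>
  moreover have "entails S \<psi> (inst zero (Or \<phi> (lift \<psi>)))"
    using wf by (simp add: entails_Or2 entails_refl wf_inst)
  then have "entails S \<psi> ?R"
    using wf by (elim entails_trans[OF _ entails_Exists_inst]) simp_all
  ultimately have "entails S (Or (Exists \<phi>) \<psi>) ?R" by (rule entails_OrE)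
  moreover have "entails S ?R (Or (Exists \<phi>) \<psi>)"
    using wf wf_lift[of "Exists \<phi>"] by (intro entails_ExistsE)
      (auto intro!: entails_Or_mono entails_lift_Exists entails_refl)
  ultimately show ?thesis by (auto simp: equivalent_def)
qed

lemma Forall_And:
  assumes wf: "wf_fm \<phi>" "wf_fm \<psi>"
  shows "equivalent S (And (Forall \<phi>) \<psi>) (Forall (And \<phi> (lift \<psi>)))"
proof -
  let ?R = "Forall (And \<phi> (lift \<psi>))"
  have "entails S (And (Forall \<phi>) \<psi>) ?R"
    using wf by (intro entails_ForallI)
      (auto intro!: entails_And_mono entails_lift_Forall entails_refl)
  moreover have "entails S ?R (Forall \<phi>)"
    using wf by (intro entails_Forall_mono entails_hyp1) auto
  moreover have "entails S (inst zero (And \<phi> (lift \<psi>))) \<psi>"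
    using wf by (simp add: entails_hyp2 wf_inst)
  then have "entails S ?R \<psi>"
    using wf entails_trans[OF entails_Forall_inst[of "And \<phi> (lift \<psi>)" zero]] by simp
  ultimately show ?thesis by (auto simp: equivalent_def entails_AndI)
qed

text \<open>From right to left \<open>\<psi>\<close> is decided first. If it holds, it is the right
  disjunct; if it fails, every instance of the disjunction must give \<open>\<phi>\<close>.\<close>

lemma Forall_Or:
  assumes wf: "wf_fm \<phi>" "wf_fm \<psi>" and dec: "S \<turnstile> Or \<psi> (Neg \<psi>)"
  shows "equivalent S (Or (Forall \<phi>) \<psi>) (Forall (Or \<phi> (lift \<psi>)))"
proof -
  let ?L = "Or (Forall \<phi>) \<psi>" and ?R = "Forall (Or \<phi> (lift \<psi>))"
  have "entails S ?L ?R"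
    using wf wf_lift[of "Forall \<phi>"] by (intro entails_ForallI)
      (auto intro!: entails_Or_mono entails_lift_Forall entails_refl)
  moreover have "entails S ?R ?L"
  proof (rule entails_cases[of S _ \<psi> "Neg \<psi>"])
    show "entails S ?R (Or \<psi> (Neg \<psi>))"
      using dec wf by (intro entails_theorem) auto
    show "entails S (And ?R \<psi>) ?L"
      using wf by (intro entails_Or2 entails_hyp2) auto
    have wfR: "wf_fm (lift ?R)" using wf by (intro wf_lift) auto
    have "entails S (lift (And ?R (Neg \<psi>))) \<phi>"
      unfolding lift_simps
    proof (rule entails_cases[of S _ \<phi> "lift \<psi>"])
      let ?H = "And (lift ?R) (Imp (lift \<psi>) Bot)"
      show "entails S ?H (Or \<phi> (lift \<psi>))"
        using wf by (intro entails_And1 entails_lift_Forall) auto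
      show "entails S (And ?H \<phi>) \<phi>"
        using wf wfR by (intro entails_hyp2) auto
      show "entails S (And ?H (lift \<psi>)) \<phi>"
        by (rule entails_contra[of S _ "lift \<psi>"])
          (use wf wfR in \<open>simp_all add: entails_prop\<close>)
    qed
    then show "entails S (And ?R (Neg \<psi>)) ?L"
      using wf by (intro entails_Or1 entails_ForallI) auto
  qed
  ultimately show ?thesis by (auto simp: equivalent_def)
qed

section \<open>Negation normal form\<close>

text \<open>\<open>nnf \<phi> Minus\<close> is the normal form of the negation of \<open>\<phi>\<close>.\<close>

primrec nnf :: "fm \<Rightarrow> sign \<Rightarrow> fm" where
  "nnf (Eq s t) c = (if c = Plus then Eq s t else Neg (Eq s t))"
| "nnf Bot c = (if c = Plus then Bot else Neg Bot)"
| "nnf (And \<phi> \<psi>) c = (if c = Plus then And else Or) (nnf \<phi> c) (nnf \<psi> c)"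
| "nnf (Or \<phi> \<psi>) c = (if c = Plus then Or else And) (nnf \<phi> c) (nnf \<psi> c)"
| "nnf (Imp \<phi> \<psi>) c = (if c = Plus then Or else And) (nnf \<phi> (flip c)) (nnf \<psi> c)"
| "nnf (Forall \<phi>) c = quant (flip c) (nnf \<phi> c)"
| "nnf (Exists \<phi>) c = quant c (nnf \<phi> c)"

lemma wf_nnf [simp]: "wf_fm (nnf \<phi> c) = wf_fm \<phi>"
  by (induction \<phi> arbitrary: c) auto

lemma fv_quant [simp]: "fv (quant c \<phi>) = {n. Suc n \<in> fv \<phi>}"
  by (cases c) auto

lemma fv_nnf [simp]: "fv (nnf \<phi> c) = fv \<phi>"
  by (induction \<phi> arbitrary: c) auto

text \<open>Both polarities go through one induction because \<open>Imp\<close> uses its premise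
  with the flipped sign. In this direction every clause is intuitionistic: a refuted conjunct
  refutes a conjunction, and a counterexample refutes a universal statement.\<close>

lemma nnf_entails:
  assumes "wf_fm \<phi>"
  shows "entails S (nnf \<phi> Plus) \<phi> \<and> entails S (nnf \<phi> Minus) (Neg \<phi>)"
  using assms
proof (induction \<phi>)
  case (And \<phi> \<psi>)
  then have "entails S (Neg \<phi>) (Neg (And \<phi> \<psi>))" "entails S (Neg \<psi>) (Neg (And \<phi> \<psi>))"
    by (auto intro!: entails_Neg_mono simp: entails_hyp1 entails_hyp2)
  then have "entails S (nnf \<phi> Minus) (Neg (And \<phi> \<psi>))" "entails S (nnf \<psi> Minus) (Neg (And \<phi> \<psi>))"
    using And entails_trans by auto
  then show ?case using And by (simp add: entails_And_mono entails_OrE)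
next
  case (Or \<phi> \<psi>)
  then show ?case
    by (simp add: entails_Or_mono entails_Neg_Or entails_And1 entails_And2)
next
  case (Imp \<phi> \<psi>)
  then have wf: "wf_fm \<phi>" "wf_fm \<psi>" by auto
  have "entails S (Or (nnf \<phi> Minus) (nnf \<psi> Plus)) (Imp \<phi> \<psi>)"
    using Imp wf entails_trans[OF _ entails_Neg_Imp, of S _ \<phi> \<psi>]
    by (simp add: entails_OrE entails_Imp_weaken)
  moreover have "entails S (And (nnf \<phi> Plus) (nnf \<psi> Minus)) (Neg (Imp \<phi> \<psi>))"
  proof (rule entails_ImpI)
    let ?H = "And (And (nnf \<phi> Plus) (nnf \<psi> Minus)) (Imp \<phi> \<psi>)"
    have "entails S ?H \<phi>" "entails S ?H (Neg \<psi>)" "entails S ?H (Imp \<phi> \<psi>)"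
      using Imp wf by (simp_all add: entails_prop)
    then show "entails S ?H Bot" using entails_ImpE by blast
  qed
  ultimately show ?case by simp
next
  case (Forall \<phi>)
  then have "entails S (nnf \<phi> Minus) (lift (Neg (Forall \<phi>)))"
    by (auto intro: entails_trans[OF _ entails_Neg_mono[OF entails_lift_Forall]])
  then show ?case using Forall by (auto intro: entails_Forall_mono entails_ExistsE)
next
  case (Exists \<phi>)
  have "entails S (lift (Forall (nnf \<phi> Minus))) (Neg \<phi>)"
    using Exists by (auto intro: entails_trans[OF entails_lift_Forall])
  then have "entails S \<phi> (lift (Neg (Forall (nnf \<phi> Minus))))"
    by (simp add: entails_Neg_swap)
  then have "entails S (Exists \<phi>) (Neg (Forall (nnf \<phi> Minus)))"
    using Exists.prems by (intro entails_ExistsE) auto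
  then have "entails S (Forall (nnf \<phi> Minus)) (Neg (Exists \<phi>))" by (rule entails_Neg_swap)
  then show ?case using Exists by (simp add: entails_Exists_mono)
qed (auto intro: entails_refl)

lemma entails_excluded_middle:
  assumes "S \<turnstile> Or \<psi> (Neg \<psi>)" "entails S (And \<phi> \<psi>) \<chi>" "entails S (And \<phi> (Neg \<psi>)) \<chi>"
  shows "entails S \<phi> \<chi>"
  using entails_wf[OF assms(2)]
  by (intro entails_cases[OF entails_theorem[OF assms(1)] assms(2,3)]) auto

text \<open>Excluded middle enters where intuitionistic logic lacks the law in question: for a
  negated conjunction, for an implication and its negation, and for a negated universal
  statement.\<close>

lemma entails_nnf:
  assumes lem: "\<And>\<phi>. wf_fm \<phi> \<Longrightarrow> S \<turnstile> Or \<phi> (Neg \<phi>)" and "wf_fm \<phi>"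
  shows "entails S \<phi> (nnf \<phi> Plus) \<and> entails S (Neg \<phi>) (nnf \<phi> Minus)"
  using assms(2)
proof (induction \<phi>)
  case (And \<phi> \<psi>)
  then have wf: "wf_fm \<phi>" "wf_fm \<psi>" by auto
  let ?H = "Neg (And \<phi> \<psi>)" and ?R = "Or (nnf \<phi> Minus) (nnf \<psi> Minus)"
  have "entails S ?H ?R"
  proof (rule entails_excluded_middle[OF lem[OF wf(1)]])
    show "entails S (And ?H (Neg \<phi>)) ?R"
      using And wf by (simp add: entails_Or1 entails_And2)
    show "entails S (And ?H \<phi>) ?R"
    proof (rule entails_excluded_middle[OF lem[OF wf(2)]])
      show "entails S (And (And ?H \<phi>) (Neg \<psi>)) ?R"
        using And wf by (simp add: entails_Or2 entails_And2)
      show "entails S (And (And ?H \<phi>) \<psi>) ?R"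
        by (rule entails_contra[of S _ "And \<phi> \<psi>"])
          (use wf in \<open>simp_all add: entails_prop\<close>)
    qed
  qed
  then show ?case using And by (simp add: entails_And_mono)
next
  case (Or \<phi> \<psi>)
  then have "entails S (Neg (Or \<phi> \<psi>)) (Neg \<phi>)" "entails S (Neg (Or \<phi> \<psi>)) (Neg \<psi>)"
    by (auto intro!: entails_Neg_mono simp: entails_Or1 entails_Or2 entails_refl)
  then have "entails S (Neg (Or \<phi> \<psi>)) (nnf \<phi> Minus)" "entails S (Neg (Or \<phi> \<psi>)) (nnf \<psi> Minus)"
    using Or entails_trans by auto
  then show ?case using Or by (simp add: entails_Or_mono entails_AndI)
next
  case (Imp \<phi> \<psi>)
  then have wf: "wf_fm \<phi>" "wf_fm \<psi>" by auto
  have IH: "entails S \<phi> (nnf \<phi> Plus)" "entails S (Neg \<phi>) (nnf \<phi> Minus)"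
    "entails S \<psi> (nnf \<psi> Plus)" "entails S (Neg \<psi>) (nnf \<psi> Minus)"
    using Imp by auto
  have "entails S (Imp \<phi> \<psi>) (Or (nnf \<phi> Minus) (nnf \<psi> Plus))"
  proof (rule entails_excluded_middle[OF lem[OF wf(1)]])
    have "entails S (And (Imp \<phi> \<psi>) \<phi>) \<psi>"
      using wf by (intro entails_ImpE[OF entails_hyp1 entails_hyp2]) auto
    then show "entails S (And (Imp \<phi> \<psi>) \<phi>) (Or (nnf \<phi> Minus) (nnf \<psi> Plus))"
      using wf by (intro entails_Or2 entails_trans[OF _ IH(3)]) auto
    show "entails S (And (Imp \<phi> \<psi>) (Neg \<phi>)) (Or (nnf \<phi> Minus) (nnf \<psi> Plus))"
      using IH wf by (simp add: entails_Or1 entails_And2)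
  qed
  moreover have "entails S (Neg (Imp \<phi> \<psi>)) \<phi>"
  proof (rule entails_excluded_middle[OF lem[OF wf(1)]])
    show "entails S (And (Neg (Imp \<phi> \<psi>)) \<phi>) \<phi>"
      using wf by (simp add: entails_hyp2)
    show "entails S (And (Neg (Imp \<phi> \<psi>)) (Neg \<phi>)) \<phi>"
      by (rule entails_contra[of S _ "Imp \<phi> \<psi>"])
        (use wf in \<open>simp_all add: entails_prop entails_Neg_Imp\<close>)
  qed
  moreover have "entails S (Neg (Imp \<phi> \<psi>)) (Neg \<psi>)"
    using wf by (intro entails_Neg_mono entails_Imp_weaken entails_refl)
  ultimately show ?case
    using entails_trans[OF _ IH(1)] entails_trans[OF _ IH(4)] by (simp add: entails_AndI)
next
  case (Forall \<phi>)
  then have wf: "wf_fm \<phi>" by simp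
  let ?E = "Exists (nnf \<phi> Minus)"
  have wfE: "wf_fm ?E" "wf_fm (lift ?E)" using wf wf_lift[of ?E] by auto
  \<comment> \<open>If there is no counterexample, deciding the generic instance
    \<open>\<phi>\<close> shows that it holds.\<close>
  have "entails S (lift (Neg ?E)) \<phi>"
    unfolding lift_simps
  proof (rule entails_excluded_middle[OF lem[OF wf]])
    show "entails S (And (Neg (lift ?E)) \<phi>) \<phi>"
      using wf wfE by (intro entails_hyp2) auto
    have E: "entails S (Neg \<phi>) (lift ?E)"
      using Forall by (auto intro: entails_trans[OF _ entails_lift_Exists])
    show "entails S (And (Neg (lift ?E)) (Neg \<phi>)) \<phi>"
      by (rule entails_contra[of S _ "lift ?E"])
        (use E wf wfE in \<open>simp_all add: entails_prop\<close>)
  qed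
  then have E: "entails S (Neg ?E) (Forall \<phi>)"
    using wf by (intro entails_ForallI) auto
  \<comment> \<open>Now the existence of a counterexample is itself decided.\<close>
  have "entails S (Neg (Forall \<phi>)) ?E"
  proof (rule entails_excluded_middle[OF lem[OF wfE(1)]])
    show "entails S (And (Neg (Forall \<phi>)) ?E) ?E"
      using wf by (intro entails_hyp2) auto
    show "entails S (And (Neg (Forall \<phi>)) (Neg ?E)) ?E"
      by (rule entails_contra[of S _ "Forall \<phi>"])
        (use wf E in \<open>simp_all add: entails_prop\<close>)
  qed
  then show ?case using Forall by (auto intro: entails_Forall_mono)
next
  case (Exists \<phi>)
  then have "entails S (lift (Neg (Exists \<phi>))) (nnf \<phi> Minus)"
    by (auto intro: entails_trans[OF entails_Neg_mono[OF entails_lift_Exists]])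
  then show ?case using Exists by (auto intro: entails_Exists_mono entails_ForallI)
qed (auto intro: entails_refl)

section \<open>Blocks of quantifiers\<close>

text \<open>A common form for the prefixes in \<open>Sigma_class\<close>, \<open>Pi_class\<close>
  and \<open>ESigma_Suc\<close>, so that the merging of two prefixes is proved once.\<close>

definition block :: "(fm \<Rightarrow> fm) \<Rightarrow> fm set \<Rightarrow> fm set" where
  "block Q K = {(Q ^^ n) \<phi> | n \<phi>. \<phi> \<in> K}"

lemma block_base: "\<phi> \<in> K \<Longrightarrow> \<phi> \<in> block Q K"
  unfolding block_def by (auto intro: exI[of _ 0])

lemma block_step: "\<phi> \<in> block Q K \<Longrightarrow> Q \<phi> \<in> block Q K"
proof -
  assume "\<phi> \<in> block Q K"
  then obtain n \<psi> where "\<phi> = (Q ^^ n) \<psi>" "\<psi> \<in> K" by (auto simp: block_def)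
  then have "Q \<phi> = (Q ^^ Suc n) \<psi>" "\<psi> \<in> K" by auto
  then show ?thesis unfolding block_def by blast
qed

lemma block_induct [consumes 1, case_names base step]:
  assumes "\<phi> \<in> block Q K" and "\<And>\<phi>. \<phi> \<in> K \<Longrightarrow> P \<phi>"
    and step: "\<And>\<phi>. \<phi> \<in> block Q K \<Longrightarrow> P \<phi> \<Longrightarrow> P (Q \<phi>)"
  shows "P \<phi>"
proof -
  obtain n \<psi> where n: "\<phi> = (Q ^^ n) \<psi>" "\<psi> \<in> K" using assms(1) by (auto simp: block_def)
  have "(Q ^^ n) \<psi> \<in> block Q K \<and> P ((Q ^^ n) \<psi>)"
    by (induction n) (auto simp: n block_base assms(2) block_step step)
  then show ?thesis by (simp add: n)
qed

lemma block_mono: "K \<subseteq> L \<Longrightarrow> block Q K \<subseteq> block Q L"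
  by (auto simp: block_def)

definition subst_closed :: "fm set \<Rightarrow> bool" where
  "subst_closed K \<longleftrightarrow> (\<forall>\<phi>\<in>K. \<forall>\<sigma>. (\<forall>n. wf_tm (\<sigma> n)) \<longrightarrow> subst \<sigma> \<phi> \<in> K)"

lemma subst_closed_lift: "subst_closed K \<Longrightarrow> \<phi> \<in> K \<Longrightarrow> lift \<phi> \<in> K"
  by (simp add: subst_closed_def lift_def)

lemma subst_closed_block:
  assumes "subst_closed K"
  shows "subst_closed (block (quant c) K)"
proof -
  have "subst \<sigma> \<phi> \<in> block (quant c) K" if "\<phi> \<in> block (quant c) K" "\<And>n. wf_tm (\<sigma> n)" for \<phi> \<sigma>
    using that
  proof (induction arbitrary: \<sigma> rule: block_induct)
    case (base \<phi>)
    then show ?case using assms by (auto simp: subst_closed_def intro: block_base)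
  next
    case (step \<phi>)
    then show ?case by (auto intro!: block_step wf_up)
  qed
  then show ?thesis by (auto simp: subst_closed_def)
qed

text \<open>The prefix of the left operand is pulled out first, then that of the right one. Each
  pull lifts the other operand, hence closure under substitution. The shift \<open>pull\<close> is a
  hypothesis, since for a universal quantifier over a disjunction it depends on decidability in
  \<open>S\<close>.\<close>

lemma block_merge:
  assumes op: "op = And \<or> op = Or"
    and wf: "\<And>\<phi>. \<phi> \<in> block (quant c) K \<Longrightarrow> wf_fm \<phi>"
    and closed: "subst_closed K"
    and pull: "\<And>\<phi> \<psi>. \<phi> \<in> block (quant c) K \<Longrightarrow> \<psi> \<in> block (quant c) K \<Longrightarrow>
      equivalent S (op (quant c \<phi>) \<psi>) (quant c (op \<phi> (lift \<psi>)))"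
    and merge: "\<And>\<phi> \<psi>. \<phi> \<in> K \<Longrightarrow> \<psi> \<in> K \<Longrightarrow> \<exists>\<chi>\<in>block (quant c) K. equivalent S (op \<phi> \<psi>) \<chi>"
    and "\<phi> \<in> block (quant c) K" "\<psi> \<in> block (quant c) K"
  shows "\<exists>\<chi>\<in>block (quant c) K. equivalent S (op \<phi> \<psi>) \<chi>"
proof -
  let ?B = "block (quant c) K"
  have comm: "equivalent S (op \<phi> \<psi>) (op \<psi> \<phi>)" if "\<phi> \<in> ?B" "\<psi> \<in> ?B" for \<phi> \<psi>
    using that op wf by (auto intro: equivalent_And_comm equivalent_Or_comm)
  have pulled: "\<exists>\<chi>\<in>?B. equivalent S (op (quant c \<phi>) \<psi>) \<chi>"
    if "\<phi> \<in> ?B" "\<psi> \<in> ?B" "\<exists>\<chi>\<in>?B. equivalent S (op \<phi> (lift \<psi>)) \<chi>" for \<phi> \<psi>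
    using that pull equivalent_quant_cong equivalent_trans block_step by meson
  have one_sided: "\<exists>\<chi>\<in>?B. equivalent S (op \<phi> \<psi>) \<chi>" if "\<phi> \<in> ?B" "\<psi> \<in> K" for \<phi> \<psi>
    using that
  proof (induction arbitrary: \<psi> rule: block_induct)
    case (base \<phi>)
    then show ?case by (rule merge)
  next
    case (step \<phi>)
    then show ?case using subst_closed_lift[OF closed] by (intro pulled) (auto intro: block_base)
  qed
  show ?thesis using assms(6,7)
  proof (induction arbitrary: \<psi> rule: block_induct)
    case (base \<phi>)
    \<comment> \<open>The left prefix is used up; after a swap, \<open>one_sided\<close> pulls out
      the prefix of \<open>\<psi>\<close>.\<close>
    then show ?case using one_sided[of \<psi> \<phi>] comm[of \<phi> \<psi>] block_base equivalent_trans by blast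
  next
    case (step \<phi>)
    then show ?case using subst_closed_lift[OF subst_closed_block[OF closed]] by (intro pulled) auto
  qed
qed

section \<open>Prenex classes\<close>

primrec prenex_class :: "sign \<Rightarrow> nat \<Rightarrow> fm set" where
  "prenex_class Plus = Sigma_class"
| "prenex_class Minus = Pi_class"

lemma prenex_class_0 [simp]: "prenex_class c 0 = {\<phi>. wf_fm \<phi> \<and> quantifier_free \<phi>}"
  by (cases c) auto

lemma prenex_class_Suc [simp]:
  "prenex_class c (Suc k) = block (quant c) (prenex_class (flip c) k)"
  by (cases c) (auto simp: block_def)

lemma quantifier_free_subst [simp]: "quantifier_free (subst \<sigma> \<phi>) = quantifier_free \<phi>"
  by (induction \<phi>) auto

lemma wf_block: "\<phi> \<in> block (quant c) K \<Longrightarrow> (\<And>\<phi>. \<phi> \<in> K \<Longrightarrow> wf_fm \<phi>) \<Longrightarrow> wf_fm \<phi>"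
  by (induction rule: block_induct) auto

lemma wf_prenex: "\<phi> \<in> prenex_class c k \<Longrightarrow> wf_fm \<phi>"
  by (induction k arbitrary: c \<phi>) (auto intro: wf_block)

lemma subst_closed_prenex: "subst_closed (prenex_class c k)"
  by (induction k arbitrary: c)
    (simp_all add: subst_closed_block, simp add: subst_closed_def wf_subst)

text \<open>One level up, the opposite sign is reached by an empty outer block, and the same sign by
  enlarging the class inside the block.\<close>

lemma prenex_class_mono: "j < k \<Longrightarrow> prenex_class c j \<subseteq> prenex_class d k"
proof -
  have step: "prenex_class c k \<subseteq> prenex_class d (Suc k)" for c d k
  proof (cases "c = d")
    case True
    have "prenex_class c k \<subseteq> prenex_class c (Suc k)"
    proof (induction k arbitrary: c)
      case 0
      then show ?case by (auto intro: block_base)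
    next
      case (Suc k)
      show ?case unfolding prenex_class_Suc[of c] by (rule block_mono[OF Suc.IH])
    qed
    then show ?thesis using True by simp
  next
    case False
    then show ?thesis by (auto simp: sign_neq_iff intro: block_base)
  qed
  show "j < k \<Longrightarrow> prenex_class c j \<subseteq> prenex_class d k"
  proof (induction k arbitrary: d)
    case (Suc k)
    then show ?case using step by (metis less_antisym order_trans)
  qed simp
qed

text \<open>Open formulas are included, so that a quantifier shift can also be made underneath other
  quantifiers.\<close>

definition decidable_below :: "fm set \<Rightarrow> nat \<Rightarrow> bool" where
  "decidable_below S k \<longleftrightarrow> (\<forall>j<k. \<forall>c. \<forall>\<phi>\<in>prenex_class c j. S \<turnstile> Or \<phi> (Neg \<phi>))"

lemma pull_quant:
  assumes "wf_fm \<phi>" "wf_fm \<psi>" and "op = And \<or> op = Or \<and> (c = Plus \<or> S \<turnstile> Or \<psi> (Neg \<psi>))"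
  shows "equivalent S (op (quant c \<phi>) \<psi>) (quant c (op \<phi> (lift \<psi>)))"
  using assms Exists_And[of \<phi> \<psi> S] Exists_Or[of \<phi> \<psi> S] Forall_And[of \<phi> \<psi> S] Forall_Or[of \<phi> \<psi> S]
  by (cases c) auto

text \<open>For disjunctions the bound is \<open>Suc k\<close>, because a universal quantifier is
  pulled over an operand that may still have level \<open>k\<close>. For conjunctions every shift is
  intuitionistic.\<close>

lemma prenex_merge:
  assumes "op = And \<or> op = Or \<and> decidable_below S (Suc k)"
    and "\<phi> \<in> prenex_class c k" "\<psi> \<in> prenex_class c k"
  shows "\<exists>\<chi>\<in>prenex_class c k. equivalent S (op \<phi> \<psi>) \<chi>"
  using assms
proof (induction k arbitrary: c \<phi> \<psi>)
  case 0
  then show ?case by (intro bexI[of _ "op \<phi> \<psi>"]) (auto intro: equivalent_refl)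
next
  case (Suc k)
  have op: "op = And \<or> op = Or \<and> decidable_below S (Suc k)"
    using Suc.prems(1) unfolding decidable_below_def by (meson less_SucI)
  show ?case unfolding prenex_class_Suc
  proof (rule block_merge[where op = op])
    show "op = And \<or> op = Or" using op by auto
    show "wf_fm \<phi>" if "\<phi> \<in> block (quant c) (prenex_class (flip c) k)" for \<phi>
      using that by (rule wf_block) (rule wf_prenex)
    show "subst_closed (prenex_class (flip c) k)" by (rule subst_closed_prenex)
    show "equivalent S (op (quant c \<phi>) \<psi>) (quant c (op \<phi> (lift \<psi>)))"
      if "\<phi> \<in> block (quant c) (prenex_class (flip c) k)"
        "\<psi> \<in> block (quant c) (prenex_class (flip c) k)" for \<phi> \<psi>
    proof (rule pull_quant[where op = op])
      have \<psi>: "\<psi> \<in> prenex_class c (Suc k)" using that by simp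
      show "op = And \<or> op = Or \<and> (c = Plus \<or> S \<turnstile> Or \<psi> (Neg \<psi>))"
        using Suc.prems(1) \<psi> unfolding decidable_below_def by blast
    qed (use that in \<open>auto intro: wf_prenex elim: wf_block\<close>)
    show "\<exists>\<chi>\<in>block (quant c) (prenex_class (flip c) k). equivalent S (op \<phi> \<psi>) \<chi>"
      if "\<phi> \<in> prenex_class (flip c) k" "\<psi> \<in> prenex_class (flip c) k" for \<phi> \<psi>
      using Suc.IH[OF op that] block_base by blast
  qed (use Suc.prems in simp_all)
qed

lemma quantifier_free_nnf: "quantifier_free \<phi> \<Longrightarrow> quantifier_free (nnf \<phi> c)"
  by (induction \<phi> arbitrary: c) auto

lemma nnf_quant: "nnf (quant c \<phi>) Minus = quant (flip c) (nnf \<phi> Minus)"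
  by (cases c) auto

lemma prenex_nnf_Minus: "\<phi> \<in> prenex_class c k \<Longrightarrow> nnf \<phi> Minus \<in> prenex_class (flip c) k"
proof (induction k arbitrary: c \<phi>)
  case 0
  then show ?case by (simp add: quantifier_free_nnf)
next
  case (Suc k)
  from Suc.prems show ?case unfolding prenex_class_Suc
  proof (induction rule: block_induct)
    case (base \<phi>)
    then show ?case using Suc.IH[of \<phi> "flip c"] by (auto intro: block_base)
  next
    case (step \<phi>)
    then show ?case by (simp add: nnf_quant block_step)
  qed
qed

section \<open>The classes \<open>E\<Pi>\<close> and \<open>E\<Sigma>\<close>\<close>

lemma ESigma_Suc_block: "ESigma_Suc k = block (quant Plus) (EPi_class k)"
  by (simp add: ESigma_Suc_def block_def)

lemma wf_EPi: "\<phi> \<in> EPi_class k \<Longrightarrow> wf_fm \<phi>"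
  by (induction rule: EPi_class.induct) (auto dest: wf_prenex[of _ Minus, simplified])

lemma subst_closed_EPi: "subst_closed (EPi_class k)"
proof -
  have "subst \<sigma> \<phi> \<in> EPi_class k" if "\<phi> \<in> EPi_class k" "\<And>n. wf_tm (\<sigma> n)" for \<phi> \<sigma>
    using that
  proof (induction arbitrary: \<sigma> rule: EPi_class.induct)
    case (base \<phi>)
    then show ?case
      using subst_closed_prenex[of Minus k] by (auto simp: subst_closed_def intro: EPi_class.base)
  qed (auto intro!: EPi_class.disj EPi_class.univ simp: wf_up)
  then show ?thesis by (auto simp: subst_closed_def)
qed

text \<open>The case of \<open>EPi_And\<close> with one prenex conjunct. Distributing over a
  disjunction and moving under a universal quantifier are both intuitionistic, so the result holds
  over every \<open>S\<close>.\<close>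

lemma EPi_And_Pi:
  assumes "\<phi> \<in> EPi_class k" "\<psi> \<in> Pi_class k"
  shows "\<exists>\<chi>\<in>EPi_class k. equivalent S (And \<psi> \<phi>) \<chi>"
  using assms
proof (induction arbitrary: \<psi> rule: EPi_class.induct)
  case (base \<phi>)
  then show ?case using prenex_merge[of And S k \<psi> Minus \<phi>] by (auto intro: EPi_class.base)
next
  case (disj \<phi>\<^sub>1 \<phi>\<^sub>2)
  then obtain \<chi>\<^sub>1 \<chi>\<^sub>2 where \<chi>: "\<chi>\<^sub>1 \<in> EPi_class k" "equivalent S (And \<psi> \<phi>\<^sub>1) \<chi>\<^sub>1"
    "\<chi>\<^sub>2 \<in> EPi_class k" "equivalent S (And \<psi> \<phi>\<^sub>2) \<chi>\<^sub>2" by meson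
  have "equivalent S (And \<psi> (Or \<phi>\<^sub>1 \<phi>\<^sub>2)) (Or (And \<psi> \<phi>\<^sub>1) (And \<psi> \<phi>\<^sub>2))"
    using \<chi>(2,4)[THEN equivalent_wf] by (intro And_Or_distrib) auto
  then have "equivalent S (And \<psi> (Or \<phi>\<^sub>1 \<phi>\<^sub>2)) (Or \<chi>\<^sub>1 \<chi>\<^sub>2)"
    using equivalent_Or_cong[OF \<chi>(2,4)] by (rule equivalent_trans)
  then show ?case using \<chi> EPi_class.disj by blast
next
  case (univ \<phi>)
  have "lift \<psi> \<in> Pi_class k"
    using subst_closed_lift[OF subst_closed_prenex[of Minus k]] univ.prems by simp
  then obtain \<chi> where \<chi>: "\<chi> \<in> EPi_class k" "equivalent S (And (lift \<psi>) \<phi>) \<chi>"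
    using univ.IH by blast
  have wf: "wf_fm \<phi>" "wf_fm \<psi>"
    using univ wf_EPi wf_prenex[of \<psi> Minus k] by auto
  have "equivalent S (And \<psi> (Forall \<phi>)) (Forall (And \<phi> (lift \<psi>)))"
    using wf by (intro equivalent_trans[OF equivalent_And_comm Forall_And]) auto
  moreover have "equivalent S (Forall (And \<phi> (lift \<psi>))) (Forall \<chi>)"
    using wf equivalent_quant_cong[OF equivalent_trans[OF equivalent_And_comm \<chi>(2)], of Minus]
    by simp
  ultimately show ?case using \<chi>(1) univ.hyps EPi_class.univ equivalent_trans by blast
qed

text \<open>The first conjunct is taken apart until it is prenex; then \<open>EPi_And_Pi\<close>
  takes apart the second.\<close>

lemma EPi_And:
  assumes "\<phi> \<in> EPi_class k" "\<psi> \<in> EPi_class k"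
  shows "\<exists>\<chi>\<in>EPi_class k. equivalent S (And \<phi> \<psi>) \<chi>"
  using assms
proof (induction arbitrary: \<psi> rule: EPi_class.induct)
  case (base \<phi>)
  then show ?case by (intro EPi_And_Pi)
next
  case (disj \<phi>\<^sub>1 \<phi>\<^sub>2)
  then obtain \<chi>\<^sub>1 \<chi>\<^sub>2 where \<chi>: "\<chi>\<^sub>1 \<in> EPi_class k" "equivalent S (And \<phi>\<^sub>1 \<psi>) \<chi>\<^sub>1"
    "\<chi>\<^sub>2 \<in> EPi_class k" "equivalent S (And \<phi>\<^sub>2 \<psi>) \<chi>\<^sub>2" by meson
  have wf: "wf_fm \<phi>\<^sub>1" "wf_fm \<phi>\<^sub>2" "wf_fm \<psi>" using disj by (auto dest: wf_EPi)
  have "equivalent S (And (Or \<phi>\<^sub>1 \<phi>\<^sub>2) \<psi>) (Or (And \<psi> \<phi>\<^sub>1) (And \<psi> \<phi>\<^sub>2))"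
    using wf by (intro equivalent_trans[OF equivalent_And_comm And_Or_distrib]) auto
  moreover have "equivalent S (And \<psi> \<phi>\<^sub>1) \<chi>\<^sub>1" "equivalent S (And \<psi> \<phi>\<^sub>2) \<chi>\<^sub>2"
    using wf \<chi> equivalent_And_comm equivalent_trans by blast+
  ultimately have "equivalent S (And (Or \<phi>\<^sub>1 \<phi>\<^sub>2) \<psi>) (Or \<chi>\<^sub>1 \<chi>\<^sub>2)"
    using equivalent_Or_cong equivalent_trans by blast
  then show ?case using \<chi> EPi_class.disj by blast
next
  case (univ \<phi>)
  have "lift \<psi> \<in> EPi_class k"
    using subst_closed_lift[OF subst_closed_EPi] univ.prems .
  then obtain \<chi> where \<chi>: "\<chi> \<in> EPi_class k" "equivalent S (And \<phi> (lift \<psi>)) \<chi>"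
    using univ.IH by blast
  have "equivalent S (And (Forall \<phi>) \<psi>) (Forall \<chi>)"
    using univ equivalent_quant_cong[OF \<chi>(2), of Minus]
    by (intro equivalent_trans[OF Forall_And]) (auto dest: wf_EPi)
  then show ?case using \<chi>(1) univ.hyps EPi_class.univ by blast
qed

text \<open>Existential quantifiers shift over both connectives intuitionistically, and inside the
  prefix \<open>EPi_class\<close> absorbs disjunctions by definition and conjunctions by
  \<open>EPi_And\<close>.\<close>

lemma ESigma_merge:
  assumes op: "op = And \<or> op = Or" and "\<phi> \<in> ESigma_Suc k" "\<psi> \<in> ESigma_Suc k"
  shows "\<exists>\<chi>\<in>ESigma_Suc k. equivalent S (op \<phi> \<psi>) \<chi>"
  unfolding ESigma_Suc_block
proof (rule block_merge[OF op])
  show "wf_fm \<phi>" if "\<phi> \<in> block (quant Plus) (EPi_class k)" for \<phi>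
    using that by (rule wf_block) (rule wf_EPi)
  show "equivalent S (op (quant Plus \<phi>) \<psi>) (quant Plus (op \<phi> (lift \<psi>)))"
    if "\<phi> \<in> block (quant Plus) (EPi_class k)" "\<psi> \<in> block (quant Plus) (EPi_class k)" for \<phi> \<psi>
    by (rule pull_quant[where op = op])
      (use that op in \<open>auto intro: wf_EPi elim: wf_block[of _ Plus, simplified]\<close>)
  have "\<exists>\<chi>\<in>EPi_class k. equivalent S (op \<phi> \<psi>) \<chi>" if "\<phi> \<in> EPi_class k" "\<psi> \<in> EPi_class k" for \<phi> \<psi>
    using op EPi_And[OF that] EPi_class.disj[OF that] equivalent_refl wf_EPi by metis
  then show "\<exists>\<chi>\<in>block (quant Plus) (EPi_class k). equivalent S (op \<phi> \<psi>) \<chi>"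
    if "\<phi> \<in> EPi_class k" "\<psi> \<in> EPi_class k" for \<phi> \<psi>
    using that block_base by meson
qed (use assms in \<open>simp_all add: subst_closed_EPi ESigma_Suc_block\<close>)

section \<open>Alternation paths\<close>

lemma Alt_quantifier_free: "quantifier_free \<phi> \<Longrightarrow> Alt \<phi> = {[]}"
  by (cases \<phi>) auto

text \<open>The quantifier-free case needs no separate clause: both subformulas then have only the
  empty path, and so does the union.\<close>

lemma Alt_connectives [simp]:
  "Alt (And \<phi> \<psi>) = Alt \<phi> \<union> Alt \<psi>"
  "Alt (Or \<phi> \<psi>) = Alt \<phi> \<union> Alt \<psi>"
  "Alt (Imp \<phi> \<psi>) = map flip ` Alt \<phi> \<union> Alt \<psi>"
  by (auto simp: Alt_quantifier_free)

declare Alt.simps(3-5) [simp del]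

lemma Alt_quant:
  "Alt (quant c \<phi>) = {s \<in> Alt \<phi>. initial s = Some c} \<union> (#) c ` {s \<in> Alt \<phi>. initial s \<noteq> Some c}"
  by (cases c) auto

lemmas Alt_Forall_Exists =
  Alt_quant[of Minus, unfolded quant.simps] Alt_quant[of Plus, unfolded quant.simps]

declare Alt.simps(6,7) [simp del]

lemma finite_Alt: "finite (Alt \<phi>)"
  by (induction \<phi>) (auto simp: Alt_Forall_Exists)

lemma Alt_nonempty: "Alt \<phi> \<noteq> {}"
  by (induction \<phi>) (auto simp: Alt_Forall_Exists)

lemma initial_Alt_quant: "s \<in> Alt (quant c \<phi>) \<Longrightarrow> initial s = Some c \<and> 0 < length s"
  by (auto simp: Alt_quant initial_def split: list.splits)

lemma flip_eq_iff: "flip a = b \<longleftrightarrow> a = flip b"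
  by (cases a; cases b) auto

lemma initial_map_flip: "initial (map flip s) = Some c \<longleftrightarrow> initial s = Some (flip c)"
  by (auto simp: initial_def flip_eq_iff split: list.splits)

lemma Alt_quant_flip:
  assumes "Alt \<psi> = map flip ` Alt \<phi>"
  shows "Alt (quant (flip c) \<psi>) = map flip ` Alt (quant c \<phi>)"
proof -
  have "{s \<in> map flip ` Alt \<phi>. initial s = Some (flip c)} =
      map flip ` {s \<in> Alt \<phi>. initial s = Some c}"
    and "{s \<in> map flip ` Alt \<phi>. initial s \<noteq> Some (flip c)} =
      map flip ` {s \<in> Alt \<phi>. initial s \<noteq> Some c}"
    by (auto simp: initial_map_flip)
  then show ?thesis by (simp add: Alt_quant assms image_Un image_image)
qed

lemma Alt_nnf: "Alt (nnf \<phi> c) = (if c = Plus then Alt \<phi> else map flip ` Alt \<phi>)"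
proof (induction \<phi> arbitrary: c)
  case (Imp \<phi> \<psi>)
  have "map flip \<circ> map flip = id" by (auto simp: fun_eq_iff comp_def)
  then show ?case using Imp by (cases c) (auto simp: image_Un image_comp)
next
  case (Forall \<phi>)
  then show ?case
    using Alt_quant_flip[of "nnf \<phi> Minus" \<phi> Minus] by (cases c) (auto simp: Alt_Forall_Exists)
next
  case (Exists \<phi>)
  then show ?case
    using Alt_quant_flip[of "nnf \<phi> Minus" \<phi> Plus] by (cases c) (auto simp: Alt_Forall_Exists)
qed auto

text \<open>The counterpart of \<open>prenex_class c k\<close> in terms of paths: those of full
  length must start with \<open>c\<close>, shorter ones are free. Excluding \<open>flip c\<close>
  instead of requiring \<open>c\<close> admits the empty path when \<open>k = 0\<close>.\<close>

definition alt_bounded :: "sign \<Rightarrow> nat \<Rightarrow> fm \<Rightarrow> bool" where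
  "alt_bounded c k \<phi> \<longleftrightarrow>
     (\<forall>s\<in>Alt \<phi>. length s < k \<or> length s = k \<and> initial s \<noteq> Some (flip c))"

lemma alt_bounded_connectives [simp]:
  "alt_bounded c k (And \<phi> \<psi>) \<longleftrightarrow> alt_bounded c k \<phi> \<and> alt_bounded c k \<psi>"
  "alt_bounded c k (Or \<phi> \<psi>) \<longleftrightarrow> alt_bounded c k \<phi> \<and> alt_bounded c k \<psi>"
  by (auto simp: alt_bounded_def)

lemma alt_bounded_quantifier_free: "quantifier_free \<phi> \<Longrightarrow> alt_bounded c k \<phi>"
  by (auto simp: alt_bounded_def Alt_quantifier_free initial_def)

lemma alt_bounded_Suc: "alt_bounded c k \<phi> \<Longrightarrow> alt_bounded d (Suc k) \<phi>"
  by (auto simp: alt_bounded_def)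

text \<open>The symbol \<open>c\<close> is prepended only to a path that is empty or starts with
  \<open>flip c\<close>. The latter is shorter than \<open>k\<close> by the bound, the former by
  \<open>0 < k\<close>.\<close>

lemma alt_bounded_quant:
  assumes "alt_bounded c k \<phi>" "0 < k"
  shows "alt_bounded c k (quant c \<phi>)"
  unfolding alt_bounded_def
proof
  fix s assume s: "s \<in> Alt (quant c \<phi>)"
  have "length s \<le> k"
  proof (cases "s \<in> Alt \<phi>")
    case True
    then show ?thesis using assms(1) by (auto simp: alt_bounded_def)
  next
    case False
    then obtain t where t: "s = c # t" "t \<in> Alt \<phi>" "initial t \<noteq> Some c"
      using s by (auto simp: Alt_quant)
    have "initial t = Some (flip c)" if "t \<noteq> []"
      using that t(3) by (cases t) (auto simp: initial_def sign_neq_iff)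
    then have "length t < k" using assms t(2) unfolding alt_bounded_def by fastforce
    then show ?thesis using t(1) by simp
  qed
  then show "length s < k \<or> length s = k \<and> initial s \<noteq> Some (flip c)"
    using initial_Alt_quant[OF s] by auto
qed

lemma alt_bounded_quantD:
  assumes "alt_bounded c k (quant c \<phi>)"
  shows "0 < k" "alt_bounded c k \<phi>"
proof -
  obtain s where "s \<in> Alt (quant c \<phi>)" using Alt_nonempty by blast
  then show "0 < k" using assms initial_Alt_quant unfolding alt_bounded_def by fastforce
  show "alt_bounded c k \<phi>" unfolding alt_bounded_def
  proof
    fix s assume s: "s \<in> Alt \<phi>"
    show "length s < k \<or> length s = k \<and> initial s \<noteq> Some (flip c)"
    proof (cases "initial s = Some c")
      case True
      then have "s \<in> Alt (quant c \<phi>)" using s by (simp add: Alt_quant)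
      then show ?thesis using assms unfolding alt_bounded_def by blast
    next
      case False
      then have "c # s \<in> Alt (quant c \<phi>)" using s by (simp add: Alt_quant)
      then show ?thesis using assms unfolding alt_bounded_def by fastforce
    qed
  qed
qed

text \<open>All paths of \<open>quant c \<phi>\<close> start with \<open>c\<close>, so under a bound
  of the opposite sign none has length \<open>k\<close>. The bound drops one level and changes its
  sign.\<close>

lemma alt_bounded_quant_flip:
  assumes "alt_bounded (flip c) k (quant c \<phi>)"
  obtains j where "k = Suc j" "alt_bounded c j (quant c \<phi>)"
proof -
  have less: "length s < k" if "s \<in> Alt (quant c \<phi>)" for s
    using assms that initial_Alt_quant[OF that] by (auto simp: alt_bounded_def)
  obtain s where "s \<in> Alt (quant c \<phi>)" using Alt_nonempty by blast
  then have "0 < k" using less by fastforce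
  then obtain j where j: "k = Suc j" using gr0_conv_Suc by blast
  then have "alt_bounded c j (quant c \<phi>)"
    using less initial_Alt_quant by (fastforce simp: alt_bounded_def)
  with j show ?thesis by (rule that)
qed

lemma alt_bounded_prenex: "\<phi> \<in> prenex_class c k \<Longrightarrow> alt_bounded c k \<phi>"
proof (induction k arbitrary: c \<phi>)
  case 0
  then show ?case by (simp add: alt_bounded_quantifier_free)
next
  case (Suc k)
  from Suc.prems show ?case unfolding prenex_class_Suc
  proof (induction rule: block_induct)
    case (base \<phi>)
    then show ?case using Suc.IH alt_bounded_Suc by blast
  next
    case (step \<phi>)
    then show ?case by (simp add: alt_bounded_quant)
  qed
qed

lemma alt_bounded_EPi: "\<phi> \<in> EPi_class k \<Longrightarrow> alt_bounded Minus k \<phi>"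
proof (induction rule: EPi_class.induct)
  case (base \<phi>)
  then show ?case using alt_bounded_prenex[of \<phi> Minus] by simp
next
  case (univ \<phi>)
  then show ?case using alt_bounded_quant[of Minus k \<phi>] by simp
qed simp

lemma alt_bounded_ESigma: "\<phi> \<in> ESigma_Suc k \<Longrightarrow> alt_bounded Plus (Suc k) \<phi>"
  unfolding ESigma_Suc_block
proof (induction rule: block_induct)
  case (base \<phi>)
  then show ?case using alt_bounded_EPi alt_bounded_Suc by blast
next
  case (step \<phi>)
  then show ?case by (intro alt_bounded_quant) auto
qed

text \<open>This separates the upper bound, which both sides of a conjunction or disjunction
  inherit, from the exactness of the degree, which they need not.\<close>

lemma E_Suc_iff:
  "\<phi> \<in> E_Suc k \<longleftrightarrow> wf_fm \<phi> \<and> alt_bounded Plus (Suc k) \<phi> \<and> (\<exists>s\<in>Alt \<phi>. length s = Suc k)"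
proof -
  \<comment> \<open>A path of positive length has a first symbol, so not starting with
    \<open>Minus\<close> means starting with \<open>Plus\<close>.\<close>
  have Plus: "initial s = Some Plus \<longleftrightarrow> initial s \<noteq> Some (flip Plus)" if "length s = Suc k" for s
    using that by (cases s) (auto simp: initial_def intro: sign.exhaust)
  have "degree \<phi> = Suc k \<longleftrightarrow> (\<exists>s\<in>Alt \<phi>. length s = Suc k) \<and> (\<forall>s\<in>Alt \<phi>. length s \<le> Suc k)"
    unfolding degree_def
    by (subst Max_eq_iff) (auto simp: finite_Alt Alt_nonempty image_iff intro: sym)
  then show ?thesis
    unfolding E_Suc_def alt_bounded_def using Plus by (auto simp: le_less)
qed

section \<open>Prenex forms of formulas in negation normal form\<close>

text \<open>Quantifier-free formulas, implications included, count as atoms, since level 0 of the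
  prenex classes contains all of them.\<close>

inductive_set nnf_class :: "fm set" where
  nnf_quantifier_free: "wf_fm \<phi> \<Longrightarrow> quantifier_free \<phi> \<Longrightarrow> \<phi> \<in> nnf_class"
| nnf_And: "\<phi> \<in> nnf_class \<Longrightarrow> \<psi> \<in> nnf_class \<Longrightarrow> And \<phi> \<psi> \<in> nnf_class"
| nnf_Or: "\<phi> \<in> nnf_class \<Longrightarrow> \<psi> \<in> nnf_class \<Longrightarrow> Or \<phi> \<psi> \<in> nnf_class"
| nnf_quantifier: "\<phi> \<in> nnf_class \<Longrightarrow> quant c \<phi> \<in> nnf_class"

lemma nnf_in_nnf_class: "wf_fm \<phi> \<Longrightarrow> nnf \<phi> c \<in> nnf_class"
  by (induction \<phi> arbitrary: c) (auto intro: nnf_class.intros)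

lemma nnf_class_prenex:
  assumes "\<phi> \<in> nnf_class" "alt_bounded c k \<phi>" "decidable_below S (Suc k)"
  shows "\<exists>\<psi>\<in>prenex_class c k. equivalent S \<phi> \<psi>"
  using assms
proof (induction arbitrary: c k rule: nnf_class.induct)
  case (nnf_quantifier_free \<phi>)
  then have "\<phi> \<in> prenex_class c k"
    using prenex_class_mono[of 0 k c c] by (cases k) auto
  then show ?case using nnf_quantifier_free equivalent_refl by blast
next
  case (nnf_And \<phi> \<psi>)
  then obtain \<phi>' \<psi>' where "\<phi>' \<in> prenex_class c k" "equivalent S \<phi> \<phi>'"
    "\<psi>' \<in> prenex_class c k" "equivalent S \<psi> \<psi>'" by (meson alt_bounded_connectives)
  then show ?case
    using prenex_merge[of And S k \<phi>' c \<psi>'] equivalent_And_cong equivalent_trans by blast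
next
  case (nnf_Or \<phi> \<psi>)
  then obtain \<phi>' \<psi>' where "\<phi>' \<in> prenex_class c k" "equivalent S \<phi> \<phi>'"
    "\<psi>' \<in> prenex_class c k" "equivalent S \<psi> \<psi>'" by (meson alt_bounded_connectives)
  then show ?case
    using prenex_merge[of Or S k \<phi>' c \<psi>'] nnf_Or.prems(2) equivalent_Or_cong equivalent_trans
    by blast
next
  case (nnf_quantifier \<phi> d)
  \<comment> \<open>Stated for every level \<open>j\<close>: when the sign of the quantifier differs
    from \<open>c\<close>, the bound drops first and this is applied one level lower.\<close>
  have same: "\<exists>\<psi>\<in>prenex_class d j. equivalent S (quant d \<phi>) \<psi>"
    if j: "alt_bounded d j (quant d \<phi>)" "decidable_below S (Suc j)" for j
  proof -
    obtain i where i: "j = Suc i" using alt_bounded_quantD(1)[OF j(1)] gr0_conv_Suc by blast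
    obtain \<psi> where "\<psi> \<in> prenex_class d j" "equivalent S \<phi> \<psi>"
      using nnf_quantifier.IH[OF alt_bounded_quantD(2)[OF j(1)] j(2)] by blast
    then show ?thesis
      using i block_step equivalent_quant_cong by (metis prenex_class_Suc)
  qed
  show ?case
  proof (cases "c = d")
    case True
    then show ?thesis using same nnf_quantifier.prems by blast
  next
    case False
    then have "alt_bounded (flip d) k (quant d \<phi>)"
      using nnf_quantifier.prems by (simp add: sign_neq_iff)
    then obtain j where j: "k = Suc j" "alt_bounded d j (quant d \<phi>)"
      by (rule alt_bounded_quant_flip)
    then have "decidable_below S (Suc j)"
      using nnf_quantifier.prems(2) unfolding decidable_below_def by (meson less_SucI)
    then show ?thesis using same j prenex_class_mono[of j k d c] by blast
  qed
qed

text \<open>Decidability is assumed only below \<open>k\<close>. At the top level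
  \<open>EPi_class\<close> absorbs disjunctions and universal quantifiers, while an existential
  subformula lies a level lower and has a prenex form.\<close>

lemma nnf_class_EPi:
  assumes "\<phi> \<in> nnf_class" "alt_bounded Minus k \<phi>" "decidable_below S k"
  shows "\<exists>\<psi>\<in>EPi_class k. equivalent S \<phi> \<psi>"
  using assms
proof (induction rule: nnf_class.induct)
  case (nnf_quantifier_free \<phi>)
  then have "\<phi> \<in> prenex_class Minus k"
    using prenex_class_mono[of 0 k Minus Minus] by (cases k) auto
  then have "\<phi> \<in> EPi_class k" by (auto intro: EPi_class.base)
  then show ?case using nnf_quantifier_free equivalent_refl by blast
next
  case (nnf_And \<phi> \<psi>)
  then obtain \<phi>' \<psi>' where "\<phi>' \<in> EPi_class k" "equivalent S \<phi> \<phi>'"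
    "\<psi>' \<in> EPi_class k" "equivalent S \<psi> \<psi>'" by (meson alt_bounded_connectives)
  then show ?case using EPi_And[of \<phi>' k \<psi>' S] equivalent_And_cong equivalent_trans by blast
next
  case (nnf_Or \<phi> \<psi>)
  then obtain \<phi>' \<psi>' where "\<phi>' \<in> EPi_class k" "equivalent S \<phi> \<phi>'"
    "\<psi>' \<in> EPi_class k" "equivalent S \<psi> \<psi>'" by (meson alt_bounded_connectives)
  then show ?case using EPi_class.disj equivalent_Or_cong by blast
next
  case (nnf_quantifier \<phi> c)
  show ?case
  proof (cases c)
    case Plus
    then have "alt_bounded (flip Plus) k (quant Plus \<phi>)" using nnf_quantifier.prems by simp
    then obtain j where j: "k = Suc j" "alt_bounded Plus j (quant Plus \<phi>)"
      by (rule alt_bounded_quant_flip)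
    \<comment> \<open>As \<open>k = Suc j\<close>, decidability below \<open>k\<close> is exactly
      what \<open>nnf_class_prenex\<close> requires at level \<open>j\<close>.\<close>
    then obtain \<psi> where "\<psi> \<in> prenex_class Plus j" "equivalent S (quant Plus \<phi>) \<psi>"
      using nnf_class_prenex nnf_class.nnf_quantifier nnf_quantifier by blast
    moreover have "prenex_class Plus j \<subseteq> Pi_class k"
      using prenex_class_mono[of j k Plus Minus] j(1) by simp
    ultimately show ?thesis using EPi_class.base Plus by blast
  next
    case Minus
    then have b: "0 < k" "alt_bounded Minus k \<phi>"
      using alt_bounded_quantD nnf_quantifier.prems by blast+
    then obtain \<psi> where "\<psi> \<in> EPi_class k" "equivalent S \<phi> \<psi>"
      using nnf_quantifier by blast
    then show ?thesis
      using b Minus EPi_class.univ equivalent_quant_cong[of S \<phi> \<psi> Minus] by auto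
  qed
qed

text \<open>A universal subformula drops to level \<open>k\<close> and is left to
  \<open>nnf_class_EPi\<close>. The other constructors are absorbed by \<open>ESigma_merge\<close>
  and by lengthening the existential prefix.\<close>

lemma nnf_class_ESigma:
  assumes "\<phi> \<in> nnf_class" "alt_bounded Plus (Suc k) \<phi>" "decidable_below S k"
  shows "\<exists>\<psi>\<in>ESigma_Suc k. equivalent S \<phi> \<psi>"
  using assms
proof (induction rule: nnf_class.induct)
  case (nnf_quantifier_free \<phi>)
  then show ?case
    using nnf_class_EPi[of \<phi> k S] nnf_class.nnf_quantifier_free alt_bounded_quantifier_free
      block_base
    unfolding ESigma_Suc_block by meson
next
  case (nnf_And \<phi> \<psi>)
  then obtain \<phi>' \<psi>' where "\<phi>' \<in> ESigma_Suc k" "equivalent S \<phi> \<phi>'"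
    "\<psi>' \<in> ESigma_Suc k" "equivalent S \<psi> \<psi>'" by (meson alt_bounded_connectives)
  then show ?case using ESigma_merge[of And \<phi>' k \<psi>' S] equivalent_And_cong equivalent_trans by blast
next
  case (nnf_Or \<phi> \<psi>)
  then obtain \<phi>' \<psi>' where "\<phi>' \<in> ESigma_Suc k" "equivalent S \<phi> \<phi>'"
    "\<psi>' \<in> ESigma_Suc k" "equivalent S \<psi> \<psi>'" by (meson alt_bounded_connectives)
  then show ?case using ESigma_merge[of Or \<phi>' k \<psi>' S] equivalent_Or_cong equivalent_trans by blast
next
  case (nnf_quantifier \<phi> c)
  show ?case
  proof (cases c)
    case Plus
    then obtain \<psi> where "\<psi> \<in> ESigma_Suc k" "equivalent S \<phi> \<psi>"
      using nnf_quantifier alt_bounded_quantD by blast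
    then show ?thesis
      using Plus equivalent_quant_cong block_step unfolding ESigma_Suc_block by blast
  next
    case Minus
    then have "alt_bounded (flip Minus) (Suc k) (quant Minus \<phi>)" using nnf_quantifier.prems by simp
    then have "alt_bounded Minus k (quant Minus \<phi>)"
      by (rule alt_bounded_quant_flip) simp
    then obtain \<psi> where "\<psi> \<in> EPi_class k" "equivalent S (quant Minus \<phi>) \<psi>"
      using nnf_class_EPi nnf_class.nnf_quantifier nnf_quantifier by blast
    then show ?thesis using Minus block_base unfolding ESigma_Suc_block by blast
  qed
qed

section \<open>Conservativity\<close>

lemma PA_excluded_middle:
  assumes "wf_fm \<phi>"
  shows "PA \<union> X \<turnstile> Or \<phi> (Neg \<phi>)"
proof -
  obtain n where n: "fv (Or \<phi> (Neg \<phi>)) \<subseteq> {..<n}" "sentence ((Forall ^^ n) (Or \<phi> (Neg \<phi>)))"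
    using obtain_closure[of "Or \<phi> (Neg \<phi>)"] assms by auto
  then have "(Forall ^^ n) (Or \<phi> (Neg \<phi>)) \<in> PA"
    using assms unfolding PA_def universal_closures_def by blast
  then have "deriv (PA \<union> X) [] ((Forall ^^ n) (Or \<phi> (Neg \<phi>)))"
    using assms by (intro Axm) auto
  then show ?thesis using n(1) unfolding provable_def by (rule deriv_of_closure)
qed

text \<open>The inclusion of theorems is applied to each axiom of \<open>T\<close>, which is a
  sentence; replacing axioms by their derivations extends this to
  \<open>T \<union> X\<close>.\<close>

lemma semi_classical_PA:
  assumes "semi_classical T" "T \<union> X \<turnstile> \<phi>"
  shows "PA \<union> X \<turnstile> \<phi>"
  unfolding provable_def
proof (rule deriv_axioms[OF assms(2)[unfolded provable_def]])
  fix \<psi> assume \<psi>: "\<psi> \<in> T \<union> X" "wf_fm \<psi>"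
  show "deriv (PA \<union> X) [] \<psi>"
  proof (cases "\<psi> \<in> T")
    case True
    then have "\<psi> \<in> theorems T"
      using assms(1) \<psi> by (auto simp: semi_classical_def theorems_def provable_def intro: Axm)
    then have "deriv PA [] \<psi>"
      using assms(1) by (auto simp: semi_classical_def theorems_def provable_def)
    then show ?thesis by (rule deriv_axioms) (auto intro: Axm)
  qed (use \<psi> in \<open>auto intro: Axm\<close>)
qed

lemma conservative_decidable_below:
  assumes cons: "conservative_over (PA \<union> X) S (ESigma_Suc k)"
  shows "decidable_below S k"
  unfolding decidable_below_def
proof (intro allI impI ballI)
  fix j c \<phi> assume j: "j < k" and \<phi>: "\<phi> \<in> prenex_class c j"
  \<comment> \<open>The dual stands in for the negation because it is again prenex; over any axioms
    it still implies \<open>Neg \<phi>\<close>.\<close>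
  let ?\<chi> = "Or \<phi> (nnf \<phi> Minus)"
  have wf: "wf_fm \<phi>" using \<phi> by (rule wf_prenex)
  then obtain n where n: "fv ?\<chi> \<subseteq> {..<n}" "sentence ((Forall ^^ n) ?\<chi>)"
    using obtain_closure[of ?\<chi>] by auto
  have "entails (PA \<union> X) (Or \<phi> (Neg \<phi>)) ?\<chi>"
    using entails_nnf[OF PA_excluded_middle wf] wf by (intro entails_Or_mono entails_refl) auto
  then have "deriv (PA \<union> X) [] ?\<chi>"
    using PA_excluded_middle[OF wf] unfolding provable_def by (rule entails_deriv)
  then have "PA \<union> X \<turnstile> (Forall ^^ n) ?\<chi>"
    unfolding provable_def by (rule deriv_closure)
  moreover have "(Forall ^^ n) ?\<chi> \<in> ESigma_Suc k"
  proof -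
    have "\<phi> \<in> Pi_class k" "nnf \<phi> Minus \<in> Pi_class k"
      using prenex_class_mono[OF j, of _ Minus] \<phi> prenex_nnf_Minus[OF \<phi>] by auto
    then have "?\<chi> \<in> EPi_class k" by (intro EPi_class.disj EPi_class.base)
    \<comment> \<open>From \<open>j < k\<close> it follows that \<open>k \<ge> 1\<close>, so closure
      under universal quantifiers is available.\<close>
    then have "(Forall ^^ n) ?\<chi> \<in> EPi_class k"
      using j by (induction n) (auto intro: EPi_class.univ)
    then show ?thesis unfolding ESigma_Suc_block by (rule block_base)
  qed
  ultimately have "deriv S [] ((Forall ^^ n) ?\<chi>)"
    using cons n(2) by (auto simp: conservative_over_def provable_def)
  then have "deriv S [] ?\<chi>" using n(1) by (rule deriv_of_closure)
  moreover have "entails S ?\<chi> (Or \<phi> (Neg \<phi>))"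
    using nnf_entails[OF wf] wf by (intro entails_Or_mono entails_refl) auto
  ultimately show "S \<turnstile> Or \<phi> (Neg \<phi>)"
    unfolding provable_def using entails_deriv by blast
qed

text \<open>Vacuous quantifiers in front of a true equation give a provable sentence of exactly
  prescribed degree and initial sign.\<close>

fun alternating_truth :: "sign \<Rightarrow> nat \<Rightarrow> fm" where
  "alternating_truth c 0 = Eq zero zero"
| "alternating_truth c (Suc k) = quant c (alternating_truth (flip c) k)"

lemma subst_alternating_truth [simp]: "subst \<sigma> (alternating_truth c k) = alternating_truth c k"
  by (induction k arbitrary: c \<sigma>) auto

lemma sentence_alternating_truth: "sentence (alternating_truth c k)"
  by (induction k arbitrary: c) (auto simp: sentence_def)

lemma deriv_alternating_truth: "deriv S [] (alternating_truth c k)"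
proof (induction k arbitrary: c)
  case 0
  then show ?case by (auto intro: EqRefl)
next
  case (Suc k)
  have "deriv S [] (inst zero (alternating_truth Minus k))"
    using Suc.IH by (simp add: inst_def)
  then show ?case
    using Suc.IH sentence_alternating_truth[of Minus k]
    by (cases c) (simp_all add: ForallI ExistsI[of _ _ zero] sentence_def)
qed

lemma Alt_alternating_truth:
  "s \<in> Alt (alternating_truth c k) \<Longrightarrow> length s = k \<and> (0 < k \<longrightarrow> initial s = Some c)"
proof (induction k arbitrary: c s)
  case (Suc k)
  \<comment> \<open>The paths of the body are empty or start with \<open>flip c\<close>, so each
    quantifier adds a symbol.\<close>
  have "initial t \<noteq> Some c" if "t \<in> Alt (alternating_truth (flip c) k)" for t
    using Suc.IH[OF that] by (cases k) (auto simp: initial_def)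
  then obtain t where "s = c # t" "t \<in> Alt (alternating_truth (flip c) k)"
    using Suc.prems by (auto simp: Alt_quant)
  then show ?case using Suc.IH by (auto simp: initial_def)
qed simp

theorem theorem6p7:
  fixes k :: nat and T X :: "fm set"
  assumes "semi_classical T"
    and "\<forall>\<phi>\<in>X. sentence \<phi>"
  shows "conservative_over (PA \<union> X) (T \<union> X) (E_Suc k) \<longleftrightarrow>
    conservative_over (PA \<union> X) (T \<union> X) (ESigma_Suc k)"
proof
  assume cons: "conservative_over (PA \<union> X) (T \<union> X) (E_Suc k)"
  show "conservative_over (PA \<union> X) (T \<union> X) (ESigma_Suc k)"
    unfolding conservative_over_def
  proof (intro ballI impI)
    fix \<phi> assume \<phi>: "\<phi> \<in> ESigma_Suc k" "sentence \<phi>" "PA \<union> X \<turnstile> \<phi>"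
    \<comment> \<open>The degree of \<open>\<phi>\<close> may be below \<open>k + 1\<close>, whereas
      \<open>E_Suc k\<close> demands that value; the conjunct \<open>?\<tau>\<close> raises it and
      is provable.\<close>
    let ?\<tau> = "alternating_truth Plus (Suc k)"
    obtain s where "s \<in> Alt ?\<tau>" using Alt_nonempty by blast
    then have "\<exists>s\<in>Alt (And \<phi> ?\<tau>). length s = Suc k"
      using Alt_alternating_truth unfolding Alt_connectives by blast
    moreover have "alt_bounded Plus (Suc k) ?\<tau>"
      unfolding alt_bounded_def using Alt_alternating_truth[of _ Plus "Suc k"] by fastforce
    moreover have "sentence (And \<phi> ?\<tau>)"
      using \<phi>(2) sentence_alternating_truth[of Plus "Suc k"] by (simp add: sentence_def)
    ultimately have "And \<phi> ?\<tau> \<in> E_Suc k" "sentence (And \<phi> ?\<tau>)"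
      using alt_bounded_ESigma[OF \<phi>(1)] unfolding E_Suc_iff
      by (auto simp: sentence_def simp del: alternating_truth.simps)
    moreover have "PA \<union> X \<turnstile> And \<phi> ?\<tau>"
      using \<phi>(3) deriv_alternating_truth unfolding provable_def by (intro AndI)
    ultimately have "T \<union> X \<turnstile> And \<phi> ?\<tau>"
      using cons unfolding conservative_over_def by blast
    then show "T \<union> X \<turnstile> \<phi>" unfolding provable_def by (rule AndE1)
  qed
next
  assume cons: "conservative_over (PA \<union> X) (T \<union> X) (ESigma_Suc k)"
  show "conservative_over (PA \<union> X) (T \<union> X) (E_Suc k)"
    unfolding conservative_over_def
  proof (intro ballI impI)
    fix \<phi> assume \<phi>: "\<phi> \<in> E_Suc k" "sentence \<phi>" "PA \<union> X \<turnstile> \<phi>"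
    then have wf: "wf_fm \<phi>" and bd: "alt_bounded Plus (Suc k) (nnf \<phi> Plus)"
      by (auto simp: E_Suc_iff alt_bounded_def Alt_nnf)
    obtain \<psi> where \<psi>: "\<psi> \<in> ESigma_Suc k" and equiv: "equivalent (T \<union> X) (nnf \<phi> Plus) \<psi>"
      using nnf_class_ESigma[OF nnf_in_nnf_class[OF wf] bd conservative_decidable_below[OF cons]]
      by blast
    have PA_nnf: "deriv (PA \<union> X) [] (nnf \<phi> Plus)"
      using entails_nnf[OF PA_excluded_middle wf, THEN conjunct1] \<phi>(3)
      unfolding provable_def by (rule entails_deriv)
    \<comment> \<open>The equivalence was obtained over \<open>T \<union> X\<close>; it is carried
      to \<open>PA \<union> X\<close> so that \<open>\<psi>\<close> becomes provable there.\<close>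
    have "PA \<union> X \<turnstile> Imp (nnf \<phi> Plus) \<psi>"
      using equiv by (intro semi_classical_PA[OF assms(1)])
        (auto simp: equivalent_def entails_def provable_def intro: ImpI)
    then have "PA \<union> X \<turnstile> \<psi>"
      using PA_nnf unfolding provable_def by (rule ImpE)
    moreover have "sentence \<psi>"
      using equiv \<phi>(2) equivalent_wf[OF equiv] by (auto simp: sentence_def equivalent_def)
    ultimately have "deriv (T \<union> X) [] \<psi>"
      using cons \<psi> by (auto simp: conservative_over_def provable_def)
    \<comment> \<open>The way back from \<open>\<psi>\<close> through the normal form to
      \<open>\<phi>\<close> stays within \<open>T \<union> X\<close>, as \<open>nnf_entails\<close>
      is intuitionistic.\<close>
    then show "T \<union> X \<turnstile> \<phi>"
      using equiv nnf_entails[OF wf, of "T \<union> X"] entails_deriv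
      unfolding equivalent_def provable_def by blast
  qed
qed

end
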